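(* Let $\alpha,\beta\in(0,1]$ and $n,d\in\mathbb{N}$. If $\mathsf{M}\colon\{-1,1\}^{n\times d}\to[-1,1]^d$ is an $(\alpha,\beta)$-weakly-accurate mechanism that is $\left(1,\frac{\beta}{4n}\right)$-differentially private, then $$n\geq \Omega\!\left(\frac{\sqrt{\alpha d}}{\log^{1.5}(\alpha d/\beta)}\right).$$
   Context: A matrix $X=(x_i^j)\in\{-1,1\}^{n\times d}$ is viewed as a dataset whose elements are its rows $x_1,\dots,x_n$. A (randomized) mechanism $\mathsf{M}$ on datasets is $(\varepsilon,\delta)$-differentially private if for every two datasets $X,X'$ differing in exactly one row and every set $T$ of outputs, $\Pr[\mathsf{M}(X)\in T]\le e^{\varepsilon}\Pr[\mathsf{M}(X')\in T]+\delta$. For $b\in\{-1,1\}$, a column $j\in[d]$ of $X$ is $b$-marked if $x_1^j=\dots=x_n^j=b$; $\mathcal{J}_X^b\subseteq[d]$ denotes the set of $b$-marked columns. A vector $q=(q^1,\dots,q^d)$ strongly-agrees with $X$ if for both $b\in\{-1,1\}$, $|\{j\in\mathcal{J}_X^b: q^j=b\}|\ge 0.9|\mathcal{J}_X^b|$. A mechanism $\mathsf{M}\colon\{-1,1\}^{n\times d}\to[-1,1]^d$ is $(\alpha,\beta)$-weakly-accurate if for every $X\in\{-1,1\}^{n\times d}$ with $|\mathcal{J}_X^1|,|\mathcal{J}_X^{-1}|\ge\frac12(1-\alpha)d$, the probability that $\mathsf{M}(X)$ strongly-agrees with $X$ is at least $\beta$. The $\Omega(\cdot)$ hides a positive absolute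 constant.
   Formalization: The bound is stated for αd/β ≥ 2; as written it is undefined for αd/β ≤ 1 (logarithm zero or negative) and fails as αd/β tends to 1 from above (e.g. d = 1, α = 1, n = 10, β → 1). *)

theory Defs
  imports "HOL-Probability.Probability"
begin

text \<open>A dataset with n rows and d columns: X i j is the entry x_i^j (0-based indices
  i < n, j < d), entries in {-1,1}; outside the index range the function is 0
  (canonical representation).\<close>
definition dataset :: "nat \<Rightarrow> nat \<Rightarrow> (nat \<Rightarrow> nat \<Rightarrow> real) \<Rightarrow> bool" where
  "dataset n d X \<longleftrightarrow>
     (\<forall>i j. (i < n \<and> j < d \<longrightarrow> X i j \<in> {-1, 1}) \<and> (\<not> (i < n \<and> j < d) \<longrightarrow> X i j = 0))"

definition neighbors :: "nat \<Rightarrow> nat \<Rightarrow> (nat \<Rightarrow> nat \<Rightarrow> real) \<Rightarrow> (nat \<Rightarrow> nat \<Rightarrow> real) \<Rightarrow> bool" where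
  "neighbors n d X X' \<longleftrightarrow> card {i. i < n \<and> (\<exists>j<d. X i j \<noteq> X' i j)} = 1"

definition out_space :: "nat \<Rightarrow> (nat \<Rightarrow> real) measure" where
  "out_space d = PiM {..<d} (\<lambda>_. restrict_space borel {-1..1})"

definition mechanism :: "nat \<Rightarrow> nat \<Rightarrow> ((nat \<Rightarrow> nat \<Rightarrow> real) \<Rightarrow> (nat \<Rightarrow> real) measure) \<Rightarrow> bool" where
  "mechanism n d M \<longleftrightarrow>
     (\<forall>X. dataset n d X \<longrightarrow> prob_space (M X) \<and> sets (M X) = sets (out_space d)
                             \<and> space (M X) = space (out_space d))"

definition diff_private ::
  "nat \<Rightarrow> nat \<Rightarrow> real \<Rightarrow> real \<Rightarrow> ((nat \<Rightarrow> nat \<Rightarrow> real) \<Rightarrow> (nat \<Rightarrow> real) measure) \<Rightarrow> bool" where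
  "diff_private n d \<epsilon> \<delta> M \<longleftrightarrow>
     (\<forall>X X' T. dataset n d X \<longrightarrow> dataset n d X' \<longrightarrow> neighbors n d X X' \<longrightarrow>
        T \<in> sets (out_space d) \<longrightarrow>
        measure (M X) T \<le> exp \<epsilon> * measure (M X') T + \<delta>)"

definition marked :: "nat \<Rightarrow> nat \<Rightarrow> (nat \<Rightarrow> nat \<Rightarrow> real) \<Rightarrow> real \<Rightarrow> nat set" where
  "marked n d X b = {j. j < d \<and> (\<forall>i<n. X i j = b)}"

definition strongly_agrees :: "nat \<Rightarrow> nat \<Rightarrow> (nat \<Rightarrow> real) \<Rightarrow> (nat \<Rightarrow> nat \<Rightarrow> real) \<Rightarrow> bool" where
  "strongly_agrees n d q X \<longleftrightarrow>
     (\<forall>b\<in>{-1, 1::real}. real (card {j \<in> marked n d X b. q j = b}) \<ge> 0.9 * real (card (marked n d X b)))"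

definition weakly_accurate ::
  "nat \<Rightarrow> nat \<Rightarrow> real \<Rightarrow> real \<Rightarrow> ((nat \<Rightarrow> nat \<Rightarrow> real) \<Rightarrow> (nat \<Rightarrow> real) measure) \<Rightarrow> bool" where
  "weakly_accurate n d \<alpha> \<beta> M \<longleftrightarrow>
     (\<forall>X. dataset n d X \<longrightarrow>
        real (card (marked n d X 1)) \<ge> (1 - \<alpha>) * real d / 2 \<longrightarrow>
        real (card (marked n d X (-1))) \<ge> (1 - \<alpha>) * real d / 2 \<longrightarrow>
        measure (M X) {q \<in> space (M X). strongly_agrees n d q X} \<ge> \<beta>)"

end

theory Submission
  imports Defs
begin

text \<open>
  The proof traces users with a fingerprinting code. A column with label \<open>m\<close> is the restriction to
  \<open>n\<close> users of a random word over a population of \<open>N\<close> users with exactly \<open>m\<close> ones, where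
  \<open>0 < m < N\<close> has prior proportional to \<open>1 / (m (N - m))\<close>; the labels \<open>0\<close> and \<open>N\<close>, of total
  prior mass \<open>1 - \<eta>\<close>, give the padding columns. User \<open>i\<close> scores \<open>x\<^sub>i - (2 m / N - 1)\<close> in a column.
  A telescoping identity shows that, given the column, the expected total score vanishes unless the
  column is marked, so an answer that agrees with the marked columns has a large total score, although
  the mechanism cannot tell padding from code. Hence some user in the data scores high. By privacy
  that user scores almost as high after the row is overwritten by ones; but then the answer is
  nearly independent of the row (up to the effect of sampling without replacement, negligible for
  \<open>N\<close> of order \<open>n\<^sup>4\<close>), so this has probability far below \<open>\<beta> / n\<close>.
\<close>

section \<open>Falling factorials and elementary inequalities\<close>

text \<open>The argument is real, so that shifts such as \<open>real N - 1\<close> involve no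
  truncated subtraction.\<close>

definition falling :: "real \<Rightarrow> nat \<Rightarrow> real" where
  "falling x k = (\<Prod>i<k. x - real i)"

lemma falling_0 [simp]: "falling x 0 = 1"
  by (simp add: falling_def)

lemma falling_Suc: "falling x (Suc k) = falling x k * (x - real k)"
  by (simp add: falling_def)

text \<open>Both sides are the falling factorial of \<open>x\<close> with \<open>k + 1\<close>
  factors, with the first or the last factor split off.\<close>

lemma falling_rec: "x * falling (x - 1) k = falling x k * (x - real k)"
proof (induction k)
  case (Suc k)
  have "x * falling (x - 1) (Suc k) = (x * falling (x - 1) k) * (x - 1 - real k)"
    by (simp add: falling_Suc)
  also have "\<dots> = falling x (Suc k) * (x - real (Suc k))"
    by (simp add: Suc falling_Suc)
  finally show ?case .
qed simp

lemma falling_nonneg: "0 \<le> falling (real m) k"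
proof (cases "k \<le> m")
  case False
  then have "m \<in> {..<k}" by simp
  then have "falling (real m) k = 0"
    unfolding falling_def by (intro prod_zero) auto
  then show ?thesis by simp
qed (auto simp: falling_def intro!: prod_nonneg)

lemma falling_pos: "k \<le> m \<Longrightarrow> 0 < falling (real m) k"
  by (auto simp: falling_def intro!: prod_pos)

lemma falling_zero: "falling 0 k = (if k = 0 then 1 else 0)"
proof (cases k)
  case (Suc j)
  then show ?thesis
    unfolding falling_def by (auto intro!: prod_zero bexI[of _ 0])
qed simp

text \<open>Vandermonde's identity in subset form, which normalises the hypergeometric weights. A
  new element left out of \<open>A\<close> or put into it contributes the factor
  \<open>y - (card R - card A)\<close> or \<open>x - card A\<close>, and these add up to
  \<open>x + y - card R\<close>.\<close>

lemma sum_Pow_falling: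
  assumes "finite R"
  shows "(\<Sum>A\<in>Pow R. falling x (card A) * falling y (card R - card A)) = falling (x + y) (card R)"
  using assms
proof (induction R rule: finite_induct)
  case (insert i R)
  let ?f = "\<lambda>r A. falling x (card A) * falling y (r - card A)"
  have "(\<Sum>A\<in>Pow (insert i R). ?f (card (insert i R)) A) =
     (\<Sum>A\<in>Pow R. ?f (Suc (card R)) A) + (\<Sum>A\<in>insert i ` Pow R. ?f (Suc (card R)) A)"
    using insert by (subst Pow_insert, subst sum.union_disjoint) (auto)
  also have "(\<Sum>A\<in>insert i ` Pow R. ?f (Suc (card R)) A) =
     (\<Sum>A\<in>Pow R. ?f (Suc (card R)) (insert i A))"
    using insert by (subst sum.reindex) (auto simp: inj_on_def insert_ident)
  also have "(\<Sum>A\<in>Pow R. ?f (Suc (card R)) A) + \<dots> =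
     (\<Sum>A\<in>Pow R. ?f (card R) A * (x + y - real (card R)))"
    unfolding sum.distrib[symmetric]
  proof (intro sum.cong refl)
    fix A assume A: "A \<in> Pow R"
    then have f: "finite A" "i \<notin> A" "card A \<le> card R"
      using insert by (auto intro: finite_subset card_mono)
    then have e: "Suc (card R) - card A = Suc (card R - card A)" by simp
    show "?f (Suc (card R)) A + ?f (Suc (card R)) (insert i A) = ?f (card R) A * (x + y - real (card R))"
      using f by (simp add: e falling_Suc of_nat_diff algebra_simps)
  qed
  also have "\<dots> = falling (x + y) (card (insert i R))"
    using insert by (simp add: sum_distrib_right[symmetric] falling_Suc)
  finally show ?case .
qed simp

text \<open>After multiplication by \<open>m * (N - m)\<close> both products on the right are
  rewritten by \<open>falling_rec\<close>. The weight \<open>1 / (m (N - m))\<close> is what turns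
  the score into a discrete difference.\<close>

lemma falling_telescope:
  fixes N m a b :: nat
  assumes "0 < m" "m < N"
  shows "falling m a * falling (real N - real m) b * (real a * N - real (a + b) * m) / (real m * (real N - real m)) =
     falling m a * falling (real N - real m - 1) b - falling (real m - 1) a * falling (real N - real m) b"
proof -
  have 1: "real m * falling (real m - 1) a = falling m a * (real m - real a)"
    by (rule falling_rec)
  have 2: "(real N - real m) * falling (real N - real m - 1) b =
      falling (real N - real m) b * (real N - real m - real b)"
    by (rule falling_rec)
  have "real m * (real N - real m) * (falling m a * falling (real N - real m - 1) b -
       falling (real m - 1) a * falling (real N - real m) b) =
     real m * falling m a * ((real N - real m) * falling (real N - real m - 1) b) -
     (real N - real m) * falling (real N - real m) b * (real m * falling (real m - 1) a)"
    by (simp add: algebra_simps)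
  also have "\<dots> = falling m a * falling (real N - real m) b * (real a * N - real (a + b) * m)"
    unfolding 1 2 by (simp add: algebra_simps)
  finally show ?thesis
    using assms by (simp add: field_simps)
qed

text \<open>Only the end points survive, and there \<open>falling 0\<close> vanishes unless
  \<open>b = 0\<close> or \<open>a = 0\<close>, that is, unless the column is constant.\<close>

lemma sum_falling_telescope:
  fixes N a b :: nat
  assumes "0 < N"
  shows "(\<Sum>m=1..<N. falling m a * falling (real N - real m) b * (real a * N - real (a + b) * m) /
         (real m * (real N - real m))) =
     falling (real N - 1) a * falling 0 b - falling 0 a * falling (real N - 1) b"
proof -
  define V where "V m = falling (real m - 1) a * falling (real N - real m) b" for m :: nat
  have "(\<Sum>m=1..<N. falling m a * falling (real N - real m) b * (real a * N - real (a + b) * m) /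
         (real m * (real N - real m))) = (\<Sum>m=1..<N. V (Suc m) - V m)"
    by (intro sum.cong refl, subst falling_telescope) (auto simp: V_def algebra_simps)
  also have "\<dots> = V N - V 1"
    using assms by (intro sum_Suc_diff') simp
  finally show ?thesis by (simp add: V_def)
qed

section \<open>Elementary bounds for exponentials and harmonic sums\<close>

lemma exp_le_quadratic:
  fixes y :: real
  assumes "\<bar>y\<bar> \<le> 1"
  shows "exp y \<le> 1 + y + y\<^sup>2"
proof (cases "0 \<le> y")
  case True
  then show ?thesis using assms exp_bound[of y] by simp
next
  case False
  define t where "t = - y"
  have t: "0 \<le> t" using False by (simp add: t_def)
  \<comment> \<open>For negative \<open>y\<close> it suffices that this product is at least 1,
    because its second factor is at most \<open>exp t\<close>.\<close>
  have "1 \<le> (1 - t + t\<^sup>2) * (1 + t + t\<^sup>2 / 2)"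
  proof -
    have "(1 - t + t\<^sup>2) * (1 + t + t\<^sup>2 / 2) = 1 + t ^ 2 / 2 + t ^ 3 / 2 + t ^ 4 / 2"
      by (simp add: field_simps power2_eq_square power3_eq_cube power4_eq_xxxx)
    then show ?thesis using t by simp
  qed
  also have "\<dots> \<le> (1 - t + t\<^sup>2) * exp t"
  proof (intro mult_left_mono)
    show "1 + t + t\<^sup>2 / 2 \<le> exp t" using exp_lower_Taylor_quadratic[OF t] by simp
    have "0 \<le> (1 - t / 2)\<^sup>2 + 3 / 4 * t\<^sup>2" by simp
    then show "0 \<le> 1 - t + t\<^sup>2" by (simp add: power2_eq_square field_simps)
  qed
  finally have "exp y \<le> (1 - t + t\<^sup>2) * exp t * exp y" by simp
  also have "\<dots> = 1 + y + y\<^sup>2" by (simp add: t_def exp_minus)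
  finally show ?thesis .
qed

text \<open>For lower tails: a quadratic penalty in the exponent lets the exponential be replaced by
  its linear part, whose mean is known exactly.\<close>

lemma exp_minus_quadratic_le:
  fixes y :: real
  assumes "\<bar>y\<bar> \<le> 1 / 2"
  shows "exp (- y - 2 * y\<^sup>2) \<le> 1 - y"
proof -
  have "\<bar>ln (1 + - y) - - y\<bar> \<le> 2 * (- y)\<^sup>2"
    using assms by (intro abs_ln_one_plus_x_minus_x_bound) simp
  then have "- y - 2 * y\<^sup>2 \<le> ln (1 - y)" by simp
  then have "exp (- y - 2 * y\<^sup>2) \<le> exp (ln (1 - y))" by simp
  also have "\<dots> = 1 - y" using assms by simp
  finally show ?thesis .
qed

text \<open>\<open>harm n - ln n\<close> decreases in \<open>n\<close> and equals 1 at
  \<open>n = 1\<close>.\<close>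

lemma harm_le_one_plus_ln: "0 < n \<Longrightarrow> harm n \<le> 1 + ln (real n)"
  using decseqD[OF decseq_harm_diff_ln, of 0 "n - 1"] by (simp add: harm_expand)

text \<open>Normalising constant of the prior on the inner labels.\<close>

definition wsum :: "nat \<Rightarrow> real" where
  "wsum N = (\<Sum>m=1..<N. 1 / (real m * (real N - real m)))"

text \<open>Partial fractions give two copies of a harmonic sum. The logarithm here becomes the
  logarithmic loss in \<open>signal\<close>.\<close>

lemma wsum_le:
  assumes "2 \<le> N"
  shows "wsum N \<le> 2 / real N * (1 + ln (real N))"
proof -
  have "wsum N = (\<Sum>m=1..<N. 1 / real N * (1 / real m + 1 / (real N - real m)))"
    unfolding wsum_def by (intro sum.cong refl) (auto simp: field_simps)
  also have "\<dots> = 1 / real N * ((\<Sum>m=1..<N. 1 / real m) + (\<Sum>m=1..<N. 1 / (real N - real m)))"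
    by (simp only: sum_distrib_left[symmetric] sum.distrib)
  also have "(\<Sum>m=1..<N. 1 / (real N - real m)) = (\<Sum>m=1..<N. 1 / real m)"
    by (rule sum.reindex_bij_witness[of _ "\<lambda>m. N - m" "\<lambda>m. N - m"]) (auto simp: of_nat_diff)
  also have "(\<Sum>m=1..<N. 1 / real m) = harm (N - 1)"
    using assms by (auto simp: harm_def inverse_eq_divide intro!: sum.cong)
  finally have w: "wsum N = 2 / real N * harm (N - 1)" by simp
  have "harm (N - 1) \<le> 1 + ln (real (N - 1))"
    using assms by (intro harm_le_one_plus_ln) simp
  also have "ln (real (N - 1)) \<le> ln (real N)" using assms by simp
  finally show ?thesis unfolding w by (intro mult_left_mono) auto
qed

lemma wsum_pos: "2 \<le> N \<Longrightarrow> 0 < wsum N"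
  unfolding wsum_def by (intro sum_pos) auto

section \<open>A single code column\<close>

text \<open>\<open>\<eta>\<close> is the prior mass of the labels strictly between 0 and
  \<open>N\<close>; \<open>2 * n \<le> N\<close> keeps the factor \<open>(N - n) / N\<close> in
  \<open>signal\<close> at least one half.\<close>

locale hypergeometric_code =
  fixes n N :: nat and \<eta> :: real
  assumes n_pos: "1 \<le> n" and N_ge: "2 * n \<le> N" and eta: "0 < \<eta>" "\<eta> \<le> 1 / 2"
begin

definition prior :: "nat \<Rightarrow> real" where
  "prior m = (if m = 0 \<or> m = N then (1 - \<eta>) / 2 else \<eta> / (wsum N * (real m * (real N - real m))))"

text \<open>Joint probability of label \<open>m\<close> and of the event that the ones among the
  \<open>n\<close> users are exactly \<open>A\<close>: the ratio of falling factorials is the chance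
  that a uniform word with \<open>m\<close> ones shows this pattern.\<close>

definition wt :: "nat \<Rightarrow> nat set \<Rightarrow> real" where
  "wt m A = prior m * (falling m (card A) * falling (real N - real m) (n - card A) / falling N n)"

text \<open>Mean of a single entry, valued in 1 and -1, given the label.\<close>

definition bias :: "nat \<Rightarrow> real" where
  "bias m = 2 * real m / real N - 1"

definition marg :: "nat set \<Rightarrow> real" where
  "marg A = (\<Sum>m\<le>N. wt m A)"

definition marksign :: "nat set \<Rightarrow> real" where
  "marksign A = (if A = {..<n} then 1 else if A = {} then -1 else 0)"

text \<open>The coefficient of \<open>fingerprint_identity\<close>, with the mass
  \<open>\<eta>\<close> divided out.\<close>

definition signal :: real where
  "signal = 2 / real N * ((real N - real n) / real N) / wsum N"

lemma N_ge_2: "2 \<le> N"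
  using n_pos N_ge by simp

lemma empty_ne_full: "{} \<noteq> {..<n}"
  using n_pos lessThan_empty_iff[of n] by (metis not_one_le_zero)

lemma wsum_N_pos: "0 < wsum N"
  using N_ge_2 by (rule wsum_pos)

lemma prior_nonneg: "m \<le> N \<Longrightarrow> 0 \<le> prior m"
  using eta wsum_N_pos by (auto simp: prior_def)

lemma sum_atMost_N:
  fixes f :: "nat \<Rightarrow> real"
  shows "(\<Sum>m\<le>N. f m) = f 0 + f N + (\<Sum>m=1..<N. f m)"
proof -
  have "{..N} = insert 0 (insert N {1..<N})" using N_ge_2 by auto
  then show ?thesis using N_ge_2 by simp
qed

lemma sum_prior_inner: "(\<Sum>m=1..<N. prior m) = \<eta>"
proof -
  have "(\<Sum>m=1..<N. prior m) = (\<Sum>m=1..<N. \<eta> / wsum N * (1 / (real m * (real N - real m))))"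
    by (intro sum.cong refl) (auto simp: prior_def)
  also have "\<dots> = \<eta> / wsum N * wsum N"
    by (simp only: sum_distrib_left[symmetric] wsum_def)
  also have "\<dots> = \<eta>" using wsum_N_pos by simp
  finally show ?thesis .
qed

lemma sum_prior: "(\<Sum>m\<le>N. prior m) = 1"
  unfolding sum_atMost_N sum_prior_inner by (simp add: prior_def)

lemma wt_nonneg: "m \<le> N \<Longrightarrow> 0 \<le> wt m A"
  unfolding wt_def
  using prior_nonneg[of m] falling_nonneg[of m] falling_nonneg[of "N - m"] falling_nonneg[of N]
  by (auto simp: of_nat_diff)

lemma marg_nonneg: "0 \<le> marg A"
  unfolding marg_def by (intro sum_nonneg wt_nonneg) auto

lemma falling_N_n_pos: "0 < falling N n"
  using N_ge by (intro falling_pos) simp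

lemma sum_wt: "m \<le> N \<Longrightarrow> (\<Sum>A\<in>Pow {..<n}. wt m A) = prior m"
  using sum_Pow_falling[of "{..<n}" "real m" "real N - real m"] falling_N_n_pos
  unfolding wt_def by (simp add: sum_distrib_left[symmetric] sum_divide_distrib[symmetric])

lemma sum_marg: "(\<Sum>A\<in>Pow {..<n}. marg A) = 1"
  unfolding marg_def by (subst sum.swap) (simp add: sum_wt sum_prior)

lemma marg_le_1: "A \<subseteq> {..<n} \<Longrightarrow> marg A \<le> 1"
  unfolding sum_marg[symmetric] by (rule member_le_sum) (auto simp: marg_nonneg)

text \<open>Exchanging ones and zeros, that is \<open>m\<close> and \<open>N - m\<close>, preserves
  the prior and swaps the two weights.\<close>

lemma marg_empty: "marg {} = marg {..<n}"
  unfolding marg_def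
proof (rule sum.reindex_bij_witness[of _ "\<lambda>m. N - m" "\<lambda>m. N - m"])
  fix m assume "m \<in> {..N}"
  then show "wt (N - m) {..<n} = wt m {}"
    by (auto simp: wt_def prior_def of_nat_diff mult.commute)
qed auto

lemma marg_full_pos: "0 < marg {..<n}"
proof -
  have "0 < wt N {..<n}"
    using falling_N_n_pos eta by (simp add: wt_def prior_def)
  also have "\<dots> \<le> marg {..<n}"
    unfolding marg_def by (rule member_le_sum) (auto simp: wt_nonneg)
  finally show ?thesis .
qed

text \<open>A padding label gives positive weight only to a constant column, and the score of that
  column is exactly zero.\<close>

lemma wt_boundary_score:
  assumes "A \<subseteq> {..<n}" "m = 0 \<or> m = N"
  shows "wt m A = 0 \<or> real (card A) - real n * m / N = 0"
proof -
  have c: "card A \<le> n" using card_mono[OF _ assms(1)] by simp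
  show ?thesis
    using assms(2) c N_ge_2 by (auto simp: wt_def falling_zero)
qed

text \<open>The fingerprinting identity. Padding labels score zero, and on inner labels the prior
  produces the telescoping sum, so that only constant columns retain a contribution.\<close>

lemma fingerprint_identity:
  assumes A: "A \<subseteq> {..<n}"
  shows "(\<Sum>m\<le>N. wt m A * (2 * (real (card A) - real n * m / N))) = \<eta> * signal * marksign A"
proof -
  let ?a = "card A"
  have c: "?a \<le> n" using card_mono[OF _ A] by simp
  have "(\<Sum>m\<le>N. wt m A * (2 * (real ?a - real n * m / N))) =
        (\<Sum>m=1..<N. wt m A * (2 * (real ?a - real n * m / N)))"
    unfolding sum_atMost_N
    using wt_boundary_score[OF A, of 0] wt_boundary_score[OF A, of N] by auto
  also have "\<dots> = (\<Sum>m=1..<N. \<eta> * 2 / (wsum N * N * falling N n) * (falling m ?a * falling (real N - real m) (n - ?a) *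
      (real ?a * N - real (?a + (n - ?a)) * m) / (real m * (real N - real m))))"
  proof (intro sum.cong refl)
    fix m assume m: "m \<in> {1..<N}"
    \<comment> \<open>Writing \<open>n\<close> as \<open>?a + (n - ?a)\<close> brings the score into
      the form of the telescoping lemma.\<close>
    have s: "2 * (real ?a - real n * m / N) = 2 / N * (real ?a * N - real (?a + (n - ?a)) * m)"
      using c N_ge_2 by (simp add: field_simps)
    have p: "prior m = \<eta> / (wsum N * (real m * (real N - real m)))"
      using m by (simp add: prior_def)
    show "wt m A * (2 * (real ?a - real n * m / N)) = \<eta> * 2 / (wsum N * N * falling N n) * (falling m ?a * falling (real N - real m) (n - ?a) *
      (real ?a * N - real (?a + (n - ?a)) * m) / (real m * (real N - real m)))"
      unfolding s wt_def p
      by (simp only: divide_inverse inverse_mult_distrib mult_ac)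
  qed
  also have "\<dots> = \<eta> * 2 / (wsum N * N * falling N n) *
      (falling (real N - 1) ?a * falling 0 (n - ?a) - falling 0 ?a * falling (real N - 1) (n - ?a))"
    unfolding sum_distrib_left[symmetric]
    by (subst sum_falling_telescope) (use N_ge_2 in auto)
  also have "falling (real N - 1) ?a * falling 0 (n - ?a) - falling 0 ?a * falling (real N - 1) (n - ?a) =
      marksign A * falling (real N - 1) n"
  proof -
    consider "A = {..<n}" | "A = {}" | "A \<noteq> {..<n}" "A \<noteq> {}" "?a \<noteq> n" "?a \<noteq> 0"
      using card_subset_eq[OF _ A] finite_subset[OF A]
      by (metis card_lessThan card_0_eq finite_lessThan)
    then show ?thesis
      using c n_pos empty_ne_full by cases (simp_all add: marksign_def falling_zero)
  qed
  \<comment> \<open>\<open>N\<close> is multiplied in and divided out so that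
    \<open>falling_rec\<close> yields \<open>falling N n * (N - n) / N\<close>, the source of the
    factor \<open>(N - n) / N\<close> in \<open>signal\<close>.\<close>
  also have "\<eta> * 2 / (wsum N * N * falling N n) * (marksign A * falling (real N - 1) n) =
     \<eta> * 2 / (wsum N * N * falling N n) * marksign A * ((real N * falling (real N - 1) n) / N)"
    using N_ge_2 by simp
  also have "\<dots> = \<eta> * signal * marksign A"
    unfolding falling_rec signal_def using falling_N_n_pos
    by (simp add: mult_ac del: right_diff_distrib_numeral)
  finally show ?thesis .
qed

lemma signal_pos: "0 < signal"
  using wsum_N_pos N_ge n_pos by (auto simp: signal_def)

text \<open>\<open>wsum_le\<close> costs one logarithm of \<open>N\<close>; the finite population
  costs at most a factor one half.\<close>

lemma signal_ge: "1 / (2 * (1 + ln (real N))) \<le> signal"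
proof -
  have l: "0 < 1 + ln (real N)" using N_ge_2 by (simp add: add_pos_nonneg)
  have h: "1 / 2 \<le> (real N - real n) / real N"
    using N_ge N_ge_2 by (simp add: field_simps flip: of_nat_mult of_nat_add)
  have "1 / (2 * (1 + ln (real N))) = 2 / real N * (1 / 2) / (2 / real N * (1 + ln (real N)))"
    using N_ge_2 l by (simp add: field_simps)
  also have "\<dots> \<le> 2 / real N * ((real N - real n) / real N) / (2 / real N * (1 + ln (real N)))"
    using h l N_ge_2 by (intro divide_right_mono mult_left_mono) auto
  also have "\<dots> \<le> signal"
    unfolding signal_def using wsum_le[OF N_ge_2] wsum_N_pos l N_ge N_ge_2
    by (intro divide_left_mono) (auto intro!: mult_pos_pos)
  finally show ?thesis .
qed

text \<open>The exponent on the right is the conditional mean, given the column, of its total score;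
  \<open>marg\<close> takes the same value on both kinds of marked columns.\<close>

lemma column_lower_tail:
  assumes A: "A \<subseteq> {..<n}" and r: "\<bar>r\<bar> \<le> 1" and l: "0 \<le> t" "2 * real n * t \<le> 1 / 2"
  shows "(\<Sum>m\<le>N. wt m A * exp (- t * (r * (2 * (real (card A) - real n * m / N)))
            - (if 0 < m \<and> m < N then 8 * t\<^sup>2 * (real n)\<^sup>2 else 0)))
         \<le> marg A * exp (- t * (\<eta> * signal / marg {..<n}) * (r * marksign A))"
proof -
  have c: "card A \<le> n" using card_mono[OF _ A] by simp
  let ?Z = "\<lambda>m::nat. 2 * (real (card A) - real n * m / N)"
  \<comment> \<open>Termwise linearisation. On inner labels the penalty \<open>8 t^2 n^2\<close>
    dominates twice the squared exponent; padding labels of positive weight score zero and carry no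
    penalty.\<close>
  have "(\<Sum>m\<le>N. wt m A * exp (- t * (r * ?Z m)
            - (if 0 < m \<and> m < N then 8 * t\<^sup>2 * (real n)\<^sup>2 else 0)))
      \<le> (\<Sum>m\<le>N. wt m A * (1 - t * (r * ?Z m)))"
  proof (rule sum_mono)
    fix m assume m: "m \<in> {..N}"
    have mN: "real n * m / N \<le> real n"
      using m N_ge_2 by (auto simp: divide_le_eq intro!: mult_left_mono)
    define w where "w = real n * m / N"
    have "0 \<le> w" "real (card A) \<le> real n" "w \<le> real n" using c mN by (auto simp: w_def)
    then have z: "\<bar>?Z m\<bar> \<le> 2 * real n"
      unfolding w_def[symmetric] by (intro abs_leI) auto
    have "\<bar>r\<bar> * \<bar>?Z m\<bar> \<le> 1 * (2 * real n)"
      by (intro mult_mono r z) auto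
    then have rz: "\<bar>r * ?Z m\<bar> \<le> 2 * real n"
      by (simp only: abs_mult mult_1)
    have y: "\<bar>t * (r * ?Z m)\<bar> \<le> t * (2 * real n)"
      unfolding abs_mult[of t] using rz l by (intro mult_mono) (auto simp del: abs_mult)
    show "wt m A * exp (- t * (r * ?Z m) - (if 0 < m \<and> m < N then 8 * t\<^sup>2 * (real n)\<^sup>2 else 0))
        \<le> wt m A * (1 - t * (r * ?Z m))"
    proof (cases "0 < m \<and> m < N")
      case True
      define u where "u = t * (r * ?Z m)"
      have u: "\<bar>u\<bar> \<le> t * (2 * real n)" using y by (simp only: u_def)
      then have "u\<^sup>2 \<le> (t * (2 * real n))\<^sup>2"
        by (metis abs_ge_zero power2_abs power_mono)
      then have "exp (- u - 8 * t\<^sup>2 * (real n)\<^sup>2) \<le> exp (- u - 2 * u\<^sup>2)"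
        by (simp add: power_mult_distrib)
      also have "\<dots> \<le> 1 - u"
        using u l by (intro exp_minus_quadratic_le) (simp add: mult_ac)
      finally have "exp (- t * (r * ?Z m) - 8 * t\<^sup>2 * (real n)\<^sup>2) \<le> 1 - t * (r * ?Z m)"
        by (simp only: u_def mult_minus_left)
      then show ?thesis using True m by (intro mult_left_mono wt_nonneg) auto
    next
      case False
      then have "m = 0 \<or> m = N" using m by auto
      from wt_boundary_score[OF A this] False show ?thesis by auto
    qed
  qed
  also have "\<dots> = marg A - t * r * (\<Sum>m\<le>N. wt m A * ?Z m)"
    unfolding marg_def sum_distrib_left sum_subtractf[symmetric]
    by (intro sum.cong refl) (simp add: algebra_simps)
  \<comment> \<open>Where \<open>marksign A\<close> is nonzero, \<open>marg A\<close> equals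
    \<open>marg {..<n}\<close> by \<open>marg_empty\<close>, so \<open>marg A\<close> can be
    factored out.\<close>
  also have "\<dots> = marg A * (1 - t * (\<eta> * signal / marg {..<n}) * (r * marksign A))"
    unfolding fingerprint_identity[OF A]
    using marg_full_pos marg_empty by (auto simp: marksign_def field_simps)
  also have "\<dots> \<le> marg A * exp (- t * (\<eta> * signal / marg {..<n}) * (r * marksign A))"
    using exp_ge_add_one_self[of "- t * (\<eta> * signal / marg {..<n}) * (r * marksign A)"]
    by (intro mult_left_mono marg_nonneg) simp
  finally show ?thesis .
qed

text \<open>Once row \<open>i\<close> is overwritten, only \<open>A\<close> and
  \<open>A - {i}\<close> remain possible. Given the other rows, the bit of user \<open>i\<close> has
  mean within \<open>2 n / (N - n)\<close> of \<open>bias m\<close>, the error of sampling without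
  replacement; the score is at most 2 in absolute value, whence the quadratic term. Under a padding
  label at most one alternative has positive weight, and it scores zero.\<close>

lemma column_upper_tail:
  assumes A: "A \<subseteq> {..<n}" "i \<in> A" and m: "m \<le> N" and r: "\<bar>r\<bar> \<le> 1" and l: "0 \<le> t" "t \<le> 1 / 2"
  shows "wt m A * exp (t * (r * (1 - bias m))) + wt m (A - {i}) * exp (t * (r * (- 1 - bias m)))
     \<le> (wt m A + wt m (A - {i})) *
         exp (if 0 < m \<and> m < N then t * (2 * real n / (real N - real n)) + 4 * t\<^sup>2 else 0)"
proof -
  have fA: "finite A" using A finite_subset by blast
  have c: "1 \<le> card A" "card A \<le> n"
    using card_mono[OF _ A(1)] A(2) fA by (auto simp: Suc_le_eq card_gt_0_iff)
  have cd: "card (A - {i}) = card A - 1" using A fA by simp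
  define b where "b = n - card A"
  have b: "n - (card A - 1) = Suc b" using c by (simp add: b_def)
  obtain a where a: "card A = Suc a" using c by (cases "card A") auto
  show ?thesis
  proof (cases "0 < m \<and> m < N")
    case False
    then consider "m = 0" | "m = N" using m by auto
    then show ?thesis
    proof cases
      case 1
      then have "wt m A = 0" using c by (simp add: wt_def falling_zero)
      then show ?thesis using 1 by (simp add: bias_def)
    next
      case 2
      then have "wt m (A - {i}) = 0" using b cd by (simp add: wt_def falling_zero)
      then show ?thesis using 2 N_ge_2 by (simp add: bias_def)
    qed
  next
    case True
    \<comment> \<open>The common factor of the other \<open>n - 1\<close> users, with
      \<open>a\<close> ones and \<open>b\<close> zeros; the bit of user \<open>i\<close> contributes
      the last factor \<open>m - a\<close> or \<open>N - m - b\<close>.\<close>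
    define kk where "kk = prior m * falling m a * falling (real N - real m) b / falling N n"
    have kk: "0 \<le> kk"
      unfolding kk_def using prior_nonneg[OF m] falling_nonneg[of m] falling_nonneg[of "N - m"] falling_nonneg[of N] m
      by (auto simp: of_nat_diff)
    have q1: "wt m A = kk * (real m - real a)"
      by (simp add: wt_def kk_def a falling_Suc b_def[unfolded a, symmetric])
    have q0: "wt m (A - {i}) = kk * (real N - real m - real b)"
      using b by (simp add: wt_def kk_def cd a falling_Suc)
    have ab: "real a + real b = real n - 1" using c a by (simp add: b_def of_nat_diff)
    have nN: "real n < real N" using N_ge n_pos by simp
    have bm: "\<bar>bias m\<bar> \<le> 1"
      using m N_ge_2 by (auto simp: bias_def abs_le_iff field_simps)
    have e: "exp (t * (r * x)) \<le> 1 + t * (r * x) + 4 * t\<^sup>2" if "\<bar>x\<bar> \<le> 2" for x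
    proof -
      have rx: "\<bar>r * x\<bar> \<le> 2"
        unfolding abs_mult using mult_mono[OF r that] by simp
      have y: "\<bar>t * (r * x)\<bar> \<le> t * 2"
        unfolding abs_mult[of t] using rx l by (intro mult_mono) auto
      then have "(t * (r * x))\<^sup>2 \<le> (t * 2)\<^sup>2"
        by (metis abs_ge_zero power2_abs power_mono)
      moreover have "exp (t * (r * x)) \<le> 1 + t * (r * x) + (t * (r * x))\<^sup>2"
        using y l by (intro exp_le_quadratic) simp
      ultimately show ?thesis by (simp add: power_mult_distrib)
    qed
    let ?q1 = "wt m A" and ?q0 = "wt m (A - {i})" and ?B = "2 * real n / (real N - real n)"
    have "?q1 * exp (t * (r * (1 - bias m))) + ?q0 * exp (t * (r * (- 1 - bias m))) \<le>
        ?q1 * (1 + t * (r * (1 - bias m)) + 4 * t\<^sup>2) + ?q0 * (1 + t * (r * (- 1 - bias m)) + 4 * t\<^sup>2)"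
      using bm m by (intro add_mono mult_left_mono e wt_nonneg) auto
    also have "\<dots> = (?q1 + ?q0) * (1 + 4 * t\<^sup>2) + t * (r * (?q1 * (1 - bias m) + ?q0 * (- 1 - bias m)))"
      by (simp add: algebra_simps)
    also have "\<dots> \<le> (?q1 + ?q0) * (1 + 4 * t\<^sup>2) + t * ((?q1 + ?q0) * ?B)"
    proof (intro add_left_mono mult_left_mono l)
      \<comment> \<open>The leading products \<open>m (N - m)\<close> cancel, leaving a term of
        order \<open>n N\<close> rather than \<open>N^2\<close>.\<close>
      have "?q1 * (1 - bias m) + ?q0 * (- 1 - bias m) =
          kk * (2 / N) * ((real m - real a) * (real N - real m) - (real N - real m - real b) * real m)"
        unfolding q1 q0 bias_def using N_ge_2 by (simp add: field_simps)
      also have "\<dots> = kk * (2 / N) * (real b * real m - real a * (real N - real m))"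
        by (simp add: algebra_simps)
      finally have eq: "?q1 * (1 - bias m) + ?q0 * (- 1 - bias m) =
          kk * (2 / N) * (real b * real m - real a * (real N - real m))" .
      have "real b * real m \<le> real n * real N" "real a * (real N - real m) \<le> real n * real N"
        using ab m by (auto intro!: mult_mono)
      moreover have "0 \<le> real b * real m" "0 \<le> real a * (real N - real m)" using m by auto
      ultimately have "\<bar>real b * real m - real a * (real N - real m)\<bar> \<le> real n * real N" by linarith
      then have "\<bar>?q1 * (1 - bias m) + ?q0 * (- 1 - bias m)\<bar> \<le> kk * (2 / N) * (real n * real N)"
        unfolding eq abs_mult using kk by (intro mult_mono) auto
      also have "\<dots> = kk * (2 * real n)" using N_ge_2 by simp
      \<comment> \<open>\<open>kk * (N - n + 1)\<close> is the total weight of the two alternatives,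
        so \<open>?B\<close> bounds the conditional mean.\<close>
      also have "\<dots> \<le> kk * ((real N - real n + 1) * ?B)"
        using kk nN by (intro mult_left_mono) (auto simp: field_simps)
      also have "\<dots> = (?q1 + ?q0) * ?B"
      proof -
        have "?q1 + ?q0 = kk * (real N - (real a + real b))" unfolding q1 q0 by (simp add: algebra_simps)
        then have "?q1 + ?q0 = kk * (real N - real n + 1)" unfolding ab by (simp add: algebra_simps)
        then show ?thesis by simp
      qed
      finally have "\<bar>?q1 * (1 - bias m) + ?q0 * (- 1 - bias m)\<bar> \<le> (?q1 + ?q0) * ?B" .
      with r have "\<bar>r * (?q1 * (1 - bias m) + ?q0 * (- 1 - bias m))\<bar> \<le> 1 * ((?q1 + ?q0) * ?B)"
        unfolding abs_mult by (intro mult_mono) auto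
      then show "r * (?q1 * (1 - bias m) + ?q0 * (- 1 - bias m)) \<le> (?q1 + ?q0) * ?B" by linarith
    qed
    also have "\<dots> = (?q1 + ?q0) * (1 + (t * ?B + 4 * t\<^sup>2))"
      by (simp add: algebra_simps)
    also have "\<dots> \<le> (?q1 + ?q0) * exp (t * ?B + 4 * t\<^sup>2)"
      using m by (intro mult_left_mono exp_ge_add_one_self add_nonneg_nonneg wt_nonneg)
    finally show ?thesis using True by simp
  qed
qed

end

section \<open>Concentration for random codebooks\<close>

text \<open>A bound valid for every fixed answer survives averaging over the random answer, whatever
  its distribution. Tail estimates for the mechanism thus reduce to sums over labels or rows with
  the answer held fixed.\<close>

lemma (in prob_space) weighted_prob_le:
  fixes w :: "'b \<Rightarrow> real"
  assumes "finite S" "\<And>z. z \<in> S \<Longrightarrow> E z \<in> events"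
    and "\<And>q. q \<in> space M \<Longrightarrow> (\<Sum>z\<in>S. w z * (if q \<in> E z then 1 else 0)) \<le> B"
  shows "(\<Sum>z\<in>S. w z * prob (E z)) \<le> B"
proof -
  have i: "integrable M (\<lambda>q. w z * indicator (E z) q)" if "z \<in> S" for z
    using assms(2)[OF that] by (simp add: emeasure_eq_measure)
  have "(\<Sum>z\<in>S. w z * prob (E z)) = (\<Sum>z\<in>S. expectation (\<lambda>q. w z * indicator (E z) q))"
    using assms(2) by (intro sum.cong refl) simp
  also have "\<dots> = expectation (\<lambda>q. \<Sum>z\<in>S. w z * indicator (E z) q)"
    using i by (subst Bochner_Integration.integral_sum) auto
  also have "\<dots> \<le> expectation (\<lambda>_. B)"
    using assms(3) i
    by (intro integral_mono Bochner_Integration.integrable_sum) (auto simp: indicator_def of_bool_def)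
  also have "\<dots> = B" by (simp add: prob_space)
  finally show ?thesis .
qed

context hypergeometric_code
begin

text \<open>Extensional functions form a finite set, over which sums of products factor into columns
  by \<open>prod_sum_PiE\<close>.\<close>

definition labels :: "nat \<Rightarrow> (nat \<Rightarrow> nat) set" where
  "labels K = PiE {..<K} (\<lambda>_. {..N})"

definition books :: "nat \<Rightarrow> (nat \<Rightarrow> nat set) set" where
  "books K = PiE {..<K} (\<lambda>_. Pow {..<n})"

definition weight :: "nat \<Rightarrow> (nat \<Rightarrow> nat) \<Rightarrow> (nat \<Rightarrow> nat set) \<Rightarrow> real" where
  "weight K m Z = (\<Prod>k<K. wt (m k) (Z k))"

definition inner_count :: "nat \<Rightarrow> (nat \<Rightarrow> nat) \<Rightarrow> real" where
  "inner_count K m = (\<Sum>k<K. if 0 < m k \<and> m k < N then 1 else 0)"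

text \<open>The expected count is \<open>\<eta> * K\<close>. On this event there are enough marked
  columns for accuracy, and the exponents of the score bounds stay of order
  \<open>\<eta> * K\<close>.\<close>

definition few_inner :: "nat \<Rightarrow> (nat \<Rightarrow> nat) \<Rightarrow> bool" where
  "few_inner K m \<longleftrightarrow> inner_count K m \<le> 8 * \<eta> * real K"

definition score :: "nat \<Rightarrow> (nat \<Rightarrow> nat) \<Rightarrow> (nat \<Rightarrow> nat set) \<Rightarrow> (nat \<Rightarrow> real) \<Rightarrow> nat \<Rightarrow> real" where
  "score K m Z r i = (\<Sum>k<K. r k * ((if i \<in> Z k then 1 else -1) - bias (m k)))"

definition correlation :: "nat \<Rightarrow> (nat \<Rightarrow> nat set) \<Rightarrow> (nat \<Rightarrow> real) \<Rightarrow> real" where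
  "correlation K Z r = (\<Sum>k<K. r k * marksign (Z k))"

text \<open>Overwrites row \<open>i\<close> by ones; the restriction keeps the result among the
  extensional codebooks.\<close>

definition fill_row :: "nat \<Rightarrow> nat \<Rightarrow> (nat \<Rightarrow> nat set) \<Rightarrow> nat \<Rightarrow> nat set" where
  "fill_row K i Z = (\<lambda>k\<in>{..<K}. insert i (Z k))"

lemma finite_labels: "finite (labels K)" and finite_books: "finite (books K)"
  unfolding labels_def books_def by (auto intro!: finite_PiE)

lemma labelsD: "m \<in> labels K \<Longrightarrow> k < K \<Longrightarrow> m k \<le> N"
  by (auto simp: labels_def PiE_iff)

lemma booksD: "Z \<in> books K \<Longrightarrow> k < K \<Longrightarrow> Z k \<subseteq> {..<n}"
  by (auto simp: books_def PiE_iff)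

lemma weight_nonneg: "m \<in> labels K \<Longrightarrow> 0 \<le> weight K m Z"
  unfolding weight_def by (auto intro!: prod_nonneg wt_nonneg dest: labelsD)

lemma sum_weight_books: "m \<in> labels K \<Longrightarrow> (\<Sum>Z\<in>books K. weight K m Z) = (\<Prod>k<K. prior (m k))"
  unfolding weight_def books_def
  by (subst prod_sum_PiE[symmetric]) (auto simp: sum_wt labelsD)

lemma sum_prior_labels: "(\<Sum>m\<in>labels K. \<Prod>k<K. prior (m k)) = 1"
  unfolding labels_def by (subst prod_sum_PiE[symmetric]) (auto simp: sum_prior)

lemma sum_marg_books: "(\<Sum>Z\<in>books K. \<Prod>k<K. marg (Z k)) = 1"
  unfolding books_def by (subst prod_sum_PiE[symmetric]) (auto simp: sum_marg)

text \<open>Chernoff's bound with parameter 1: the exponential moment is at most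
  \<open>exp (2 * \<eta> * K)\<close>, against the threshold \<open>8 * \<eta> * K\<close>.\<close>

lemma few_inner_prob:
  assumes "exp (- 6 * \<eta> * real K) \<le> 1 / 8"
  shows "7 / 8 \<le> (\<Sum>m\<in>{m\<in>labels K. few_inner K m}. \<Sum>Z\<in>books K. weight K m Z)"
proof -
  let ?P = "\<lambda>m. \<Prod>k<K. prior (m k)"
  have P0: "0 \<le> ?P m" if "m \<in> labels K" for m
    using that by (auto intro!: prod_nonneg prior_nonneg dest: labelsD)
  have "(\<Sum>m\<in>{m\<in>labels K. \<not> few_inner K m}. ?P m) \<le>
     (\<Sum>m\<in>{m\<in>labels K. \<not> few_inner K m}. ?P m * exp (inner_count K m - 8 * \<eta> * real K))"
  proof (intro sum_mono)
    fix m assume "m \<in> {m\<in>labels K. \<not> few_inner K m}"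
    then show "?P m \<le> ?P m * exp (inner_count K m - 8 * \<eta> * real K)"
      using P0[of m] by (intro mult_le_cancel_left1[THEN iffD2]) (auto simp: few_inner_def)
  qed
  also have "\<dots> \<le> (\<Sum>m\<in>labels K. ?P m * exp (inner_count K m - 8 * \<eta> * real K))"
    using P0 by (intro sum_mono2 finite_labels) auto
  also have "\<dots> = exp (- 8 * \<eta> * real K) *
      (\<Sum>m\<in>labels K. \<Prod>k<K. prior (m k) * exp (if 0 < m k \<and> m k < N then 1 else 0))"
    unfolding sum_distrib_left inner_count_def exp_diff exp_sum[OF finite_lessThan] prod.distrib
    by (intro sum.cong refl) (simp add: exp_minus field_simps)
  also have "\<dots> = exp (- 8 * \<eta> * real K) * (\<Prod>k<K. \<Sum>m\<le>N. prior m * exp (if 0 < m \<and> m < N then 1 else 0))"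
    unfolding labels_def by (subst prod_sum_PiE) auto
  also have "(\<Sum>m\<le>N. prior m * exp (if 0 < m \<and> m < N then 1 else 0)) = 1 - \<eta> + \<eta> * exp 1"
  proof -
    have "(\<Sum>m=1..<N. prior m * exp (if 0 < m \<and> m < N then 1 else 0)) = (\<Sum>m=1..<N. prior m) * exp 1"
      unfolding sum_distrib_right by (intro sum.cong) auto
    then show ?thesis
      unfolding sum_atMost_N sum_prior_inner by (simp add: prior_def)
  qed
  also have "exp (- 8 * \<eta> * real K) * (\<Prod>k<K. 1 - \<eta> + \<eta> * exp 1) \<le>
      exp (- 8 * \<eta> * real K) * (\<Prod>k<K. exp (2 * \<eta>))"
  proof (intro mult_left_mono prod_mono conjI)
    have "1 - \<eta> + \<eta> * exp 1 \<le> 1 - \<eta> + \<eta> * 3"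
      using eta exp_le by (intro add_left_mono mult_left_mono) auto
    also have "\<dots> = 1 + 2 * \<eta>" by simp
    also have "\<dots> \<le> exp (2 * \<eta>)" by (rule exp_ge_add_one_self)
    finally show "1 - \<eta> + \<eta> * exp 1 \<le> exp (2 * \<eta>)" .
    show "0 \<le> 1 - \<eta> + \<eta> * exp 1" using eta by simp
  qed auto
  also have "\<dots> = exp (- 6 * \<eta> * real K)"
    by (simp add: exp_of_nat_mult[symmetric] exp_add[symmetric] algebra_simps)
  also have "\<dots> \<le> 1 / 8" by fact
  finally have *: "(\<Sum>m\<in>{m\<in>labels K. \<not> few_inner K m}. ?P m) \<le> 1 / 8" .
  have "1 = (\<Sum>m\<in>{m\<in>labels K. few_inner K m} \<union> {m\<in>labels K. \<not> few_inner K m}. ?P m)"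
    unfolding sum_prior_labels[of K, symmetric] by (intro sum.cong) auto
  also have "\<dots> = (\<Sum>m\<in>{m\<in>labels K. few_inner K m}. ?P m) + (\<Sum>m\<in>{m\<in>labels K. \<not> few_inner K m}. ?P m)"
    using finite_labels by (intro sum.union_disjoint) auto
  finally show ?thesis using * by (simp add: sum_weight_books)
qed

lemma sum_scores:
  assumes Z: "Z \<in> books K"
  shows "(\<Sum>i<n. score K m Z r i) = (\<Sum>k<K. r k * (2 * (real (card (Z k)) - real n * m k / N)))"
proof -
  have "(\<Sum>i<n. (if i \<in> A then 1 else -1) - bias j) = 2 * (real (card A) - real n * j / N)"
    if "A \<subseteq> {..<n}" for A j
  proof -
    have "(\<Sum>i<n. (if i \<in> A then 1 else -1 :: real)) = (\<Sum>i<n. 2 * (if i \<in> A then 1 else 0) - 1)"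
      by (intro sum.cong) auto
    also have "\<dots> = 2 * real (card ({..<n} \<inter> A)) - real n"
      by (simp add: sum_subtractf sum_distrib_left[symmetric] sum.If_cases)
    also have "{..<n} \<inter> A = A" using that by auto
    finally have S: "(\<Sum>i<n. (if i \<in> A then 1 else -1 :: real)) = 2 * real (card A) - real n" .
    show ?thesis unfolding sum_subtractf S by (simp add: bias_def algebra_simps)
  qed
  then show ?thesis
    unfolding score_def by (subst sum.swap) (auto simp: sum_distrib_left[symmetric] booksD[OF Z] intro!: sum.cong)
qed

text \<open>Answer and codebook are fixed and only the labels vary, independently over columns. The
  exponential moment with tilt \<open>-t\<close> factors into instances of
  \<open>column_lower_tail\<close>; correlation with the marked columns supplies the negative drift,
  and \<open>few_inner\<close> bounds the accumulated penalty by
  \<open>64 t^2 n^2 \<eta> K\<close>.\<close>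

lemma book_lower_tail:
  assumes Z: "Z \<in> books K" and r: "\<And>k. k < K \<Longrightarrow> \<bar>r k\<bar> \<le> 1"
    and t: "0 \<le> t" "2 * real n * t \<le> 1 / 2"
    and corr: "3 / 10 * real K \<le> correlation K Z r" and D: "0 \<le> D" "D \<le> signal"
  shows "(\<Sum>m\<in>{m\<in>labels K. few_inner K m}. weight K m Z * (if (\<Sum>i<n. score K m Z r i) \<le> \<theta> then 1 else 0))
    \<le> exp (t * \<theta> + 64 * t\<^sup>2 * (real n)\<^sup>2 * \<eta> * K - t * (\<eta> * D * (3 / 10 * real K))) * (\<Prod>k<K. marg (Z k))"
proof -
  let ?c = "8 * t\<^sup>2 * (real n)\<^sup>2"
  let ?s = "\<lambda>m k. 2 * (real (card (Z k)) - real n * m / N)"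
  let ?g = "\<lambda>m k. wt m (Z k) * exp (- t * (r k * ?s m k) - (if 0 < m \<and> m < N then ?c else 0))"
  define G where "G = \<eta> * signal / marg {..<n}"
  have "(\<Sum>m\<in>{m\<in>labels K. few_inner K m}. weight K m Z * (if (\<Sum>i<n. score K m Z r i) \<le> \<theta> then 1 else 0)) \<le>
     (\<Sum>m\<in>{m\<in>labels K. few_inner K m}. exp (t * \<theta> + ?c * (8 * \<eta> * K)) * (\<Prod>k<K. ?g (m k) k))"
  proof (intro sum_mono)
    fix m assume m: "m \<in> {m\<in>labels K. few_inner K m}"
    have e: "(\<Prod>k<K. ?g (m k) k) = weight K m Z * exp (- t * (\<Sum>i<n. score K m Z r i) - ?c * inner_count K m)"
      unfolding weight_def prod.distrib exp_sum[OF finite_lessThan, symmetric] sum_scores[OF Z]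
        inner_count_def sum_distrib_left sum_subtractf
      by (intro arg_cong2[of _ _ _ _ "(*)"] arg_cong[of _ _ exp] arg_cong2[of _ _ _ _ "(-)"] refl sum.cong) auto
    have "(if (\<Sum>i<n. score K m Z r i) \<le> \<theta> then 1 else 0) \<le>
        exp (t * \<theta> + ?c * (8 * \<eta> * K)) * exp (- t * (\<Sum>i<n. score K m Z r i) - ?c * inner_count K m)"
    proof (cases "(\<Sum>i<n. score K m Z r i) \<le> \<theta>")
      case True
      have "t * (\<Sum>i<n. score K m Z r i) \<le> t * \<theta>" using True t by (intro mult_left_mono)
      moreover have "?c * inner_count K m \<le> ?c * (8 * \<eta> * K)"
        using m by (intro mult_left_mono) (auto simp: few_inner_def)
      ultimately have "0 \<le> (t * \<theta> + ?c * (8 * \<eta> * K)) + (- (t * (\<Sum>i<n. score K m Z r i)) - ?c * inner_count K m)"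
        by linarith
      then show ?thesis
        using True by (simp only: if_True exp_add[symmetric] one_le_exp_iff mult_minus_left)
    qed simp
    from mult_left_mono[OF this weight_nonneg[of m K Z]] m
    show "weight K m Z * (if (\<Sum>i<n. score K m Z r i) \<le> \<theta> then 1 else 0) \<le>
        exp (t * \<theta> + ?c * (8 * \<eta> * K)) * (\<Prod>k<K. ?g (m k) k)"
      unfolding e by (simp only: mem_Collect_eq mult_ac)
  qed
  \<comment> \<open>\<open>few_inner\<close> has already paid for the penalty; summing over all
    labels restores the product structure.\<close>
  also have "\<dots> \<le> (\<Sum>m\<in>labels K. exp (t * \<theta> + ?c * (8 * \<eta> * K)) * (\<Prod>k<K. ?g (m k) k))"
    by (intro sum_mono2 finite_labels mult_nonneg_nonneg prod_nonneg wt_nonneg)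
      (auto dest: labelsD)
  also have "\<dots> = exp (t * \<theta> + ?c * (8 * \<eta> * K)) * (\<Prod>k<K. \<Sum>m\<le>N. ?g m k)"
    unfolding labels_def sum_distrib_left[symmetric] by (subst prod_sum_PiE) auto
  also have "\<dots> \<le> exp (t * \<theta> + ?c * (8 * \<eta> * K)) * (\<Prod>k<K. marg (Z k) * exp (- t * G * (r k * marksign (Z k))))"
    unfolding G_def using r t
    by (intro mult_left_mono prod_mono conjI column_lower_tail booksD[OF Z] sum_nonneg mult_nonneg_nonneg wt_nonneg) auto
  also have "\<dots> = exp (t * \<theta> + ?c * (8 * \<eta> * K) - t * G * correlation K Z r) * (\<Prod>k<K. marg (Z k))"
    unfolding prod.distrib exp_sum[OF finite_lessThan, symmetric] sum_distrib_left[symmetric] correlation_def[symmetric]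
    by (simp add: exp_diff exp_minus field_simps)
  also have "\<dots> \<le> exp (t * \<theta> + 64 * t\<^sup>2 * (real n)\<^sup>2 * \<eta> * K - t * (\<eta> * D * (3 / 10 * real K))) * (\<Prod>k<K. marg (Z k))"
  proof (intro mult_right_mono prod_nonneg)
    \<comment> \<open>As \<open>marg {..<n}\<close> is at most 1, dividing by it only increases the
      signal, so \<open>D\<close> is a safe replacement.\<close>
    have "D * 1 \<le> signal * (1 / marg {..<n})"
      using D marg_le_1[of "{..<n}"] marg_full_pos by (intro mult_mono) auto
    from mult_left_mono[OF this, of \<eta>] have "\<eta> * D \<le> G"
      unfolding G_def using eta by simp
    moreover have "0 \<le> G"
      unfolding G_def using eta signal_pos marg_full_pos by simp
    ultimately have "t * (\<eta> * D * (3 / 10 * real K)) \<le> t * (G * correlation K Z r)"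
      using t corr D eta by (intro mult_left_mono mult_mono) auto
    then show "exp (t * \<theta> + ?c * (8 * \<eta> * K) - t * G * correlation K Z r) \<le>
        exp (t * \<theta> + 64 * t\<^sup>2 * (real n)\<^sup>2 * \<eta> * K - t * (\<eta> * D * (3 / 10 * real K)))"
      by (simp add: mult_ac)
  qed (auto simp: marg_nonneg)
  finally show ?thesis .
qed

text \<open>The overwritten book leaves one free bit per column, so the fibre is a product set and
  sums over row \<open>i\<close> factor.\<close>

lemma fill_row_fiber:
  assumes Z: "Z \<in> books K" and i: "i < n"
  shows "{Y \<in> books K. fill_row K i Y = fill_row K i Z} =
    PiE {..<K} (\<lambda>k. {fill_row K i Z k, fill_row K i Z k - {i}})"
proof (intro set_eqI iffI)
  fix Y assume "Y \<in> {Y \<in> books K. fill_row K i Y = fill_row K i Z}"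
  then have Y0: "Y \<in> books K" "fill_row K i Y = fill_row K i Z" by auto
  have Y: "Y \<in> books K" "insert i (Y k) = fill_row K i Z k" if "k < K" for k
    using Y0(1) that fun_cong[OF Y0(2), unfolded fill_row_def, of k] by (simp_all add: fill_row_def)
  have "Y k = fill_row K i Z k \<or> Y k = fill_row K i Z k - {i}" if "k < K" for k
    unfolding Y(2)[OF that, symmetric] by (cases "i \<in> Y k") auto
  then show "Y \<in> PiE {..<K} (\<lambda>k. {fill_row K i Z k, fill_row K i Z k - {i}})"
    using Y0(1) by (auto simp: books_def PiE_iff)
next
  fix Y assume Y: "Y \<in> PiE {..<K} (\<lambda>k. {fill_row K i Z k, fill_row K i Z k - {i}})"
  have s: "fill_row K i Z k \<subseteq> {..<n}" "i \<in> fill_row K i Z k" if "k < K" for k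
    using booksD[OF Z that] that i by (auto simp: fill_row_def)
  have Yk: "Y k = fill_row K i Z k \<or> Y k = fill_row K i Z k - {i}" if "k < K" for k
    using Y that by (auto simp: PiE_iff)
  have "Y \<in> books K"
    using Y Yk s by (auto simp: books_def PiE_iff)
  moreover have "insert i (Y k) = insert i (Z k)" if "k < K" for k
    using Yk[OF that] that by (auto simp: fill_row_def)
  then have "fill_row K i Y = fill_row K i Z"
    unfolding fill_row_def by (intro restrict_ext) auto
  ultimately show "Y \<in> {Y \<in> books K. fill_row K i Y = fill_row K i Z}" by simp
qed

lemma fill_row_books: "Z \<in> books K \<Longrightarrow> i < n \<Longrightarrow> fill_row K i Z \<in> books K"
  by (auto simp: books_def fill_row_def PiE_iff)

text \<open>With labels, other rows and answer fixed, the bits of row \<open>i\<close> are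
  independent, and Chernoff's bound factors into instances of \<open>column_upper_tail\<close>. Only
  inner labels contribute, at most \<open>8 * \<eta> * K\<close> of them.\<close>

lemma row_upper_tail:
  assumes Z: "Z \<in> books K" and i: "i < n" and m: "m \<in> labels K" "few_inner K m"
    and r: "\<And>k. k < K \<Longrightarrow> \<bar>r k\<bar> \<le> 1" and t: "0 \<le> t" "t \<le> 1 / 2"
  shows "(\<Sum>Y\<in>{Y \<in> books K. fill_row K i Y = fill_row K i Z}. weight K m Y * (if \<tau> < score K m Y r i then 1 else 0))
    \<le> exp (8 * \<eta> * K * (t * (2 * real n / (real N - real n)) + 4 * t\<^sup>2) - t * \<tau>) *
      (\<Sum>Y\<in>{Y \<in> books K. fill_row K i Y = fill_row K i Z}. weight K m Y)"
proof -
  let ?F = "{Y \<in> books K. fill_row K i Y = fill_row K i Z}"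
  let ?A = "fill_row K i Z"
  let ?c = "t * (2 * real n / (real N - real n)) + 4 * t\<^sup>2"
  let ?s = "\<lambda>k B. (if i \<in> B then 1 else -1) - bias (m k)"
  have A: "?A k \<subseteq> {..<n}" "i \<in> ?A k" if "k < K" for k
    using booksD[OF Z that] that i by (auto simp: fill_row_def)
  have pr: "(\<Sum>Y\<in>?F. \<Prod>k<K. g k (Y k)) = (\<Prod>k<K. g k (?A k) + g k (?A k - {i}))" for g :: "nat \<Rightarrow> nat set \<Rightarrow> real"
  proof -
    have "(\<Sum>Y\<in>?F. \<Prod>k<K. g k (Y k)) = (\<Prod>k<K. \<Sum>B\<in>{?A k, ?A k - {i}}. g k B)"
      unfolding fill_row_fiber[OF Z i] by (subst prod_sum_PiE) auto
    also have "\<dots> = (\<Prod>k<K. g k (?A k) + g k (?A k - {i}))"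
    proof (intro prod.cong refl)
      fix k assume "k \<in> {..<K}"
      \<comment> \<open>As \<open>i\<close> lies in the filled column, the two alternatives are
        distinct and each is counted once.\<close>
      then have "?A k \<noteq> ?A k - {i}" using A by auto
      then show "(\<Sum>B\<in>{?A k, ?A k - {i}}. g k B) = g k (?A k) + g k (?A k - {i})" by simp
    qed
    finally show ?thesis .
  qed
  have "(\<Sum>Y\<in>?F. weight K m Y * (if \<tau> < score K m Y r i then 1 else 0)) \<le>
      (\<Sum>Y\<in>?F. exp (- t * \<tau>) * (\<Prod>k<K. wt (m k) (Y k) * exp (t * (r k * ?s k (Y k)))))"
  proof (intro sum_mono)
    fix Y
    have e: "(\<Prod>k<K. wt (m k) (Y k) * exp (t * (r k * ?s k (Y k)))) = weight K m Y * exp (t * score K m Y r i)"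
      unfolding weight_def prod.distrib exp_sum[OF finite_lessThan, symmetric] score_def sum_distrib_left ..
    have "(if \<tau> < score K m Y r i then 1 else 0) \<le> exp (- t * \<tau>) * exp (t * score K m Y r i)"
      using t by (auto simp: exp_add[symmetric] mult_left_mono)
    from mult_left_mono[OF this weight_nonneg[OF m(1), of Y]]
    show "weight K m Y * (if \<tau> < score K m Y r i then 1 else 0) \<le>
        exp (- t * \<tau>) * (\<Prod>k<K. wt (m k) (Y k) * exp (t * (r k * ?s k (Y k))))"
      unfolding e by (simp only: mult_ac)
  qed
  also have "\<dots> = exp (- t * \<tau>) * (\<Prod>k<K. wt (m k) (?A k) * exp (t * (r k * ?s k (?A k))) +
      wt (m k) (?A k - {i}) * exp (t * (r k * ?s k (?A k - {i}))))"
    unfolding sum_distrib_left[symmetric] pr[of "\<lambda>k B. wt (m k) B * exp (t * (r k * ?s k B))"] ..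
  also have "\<dots> \<le> exp (- t * \<tau>) * (\<Prod>k<K. (wt (m k) (?A k) + wt (m k) (?A k - {i})) *
      exp (if 0 < m k \<and> m k < N then ?c else 0))"
  proof (intro mult_left_mono prod_mono conjI)
    fix k assume "k \<in> {..<K}"
    then have k: "k < K" by simp
    show "wt (m k) (?A k) * exp (t * (r k * ?s k (?A k))) +
        wt (m k) (?A k - {i}) * exp (t * (r k * ?s k (?A k - {i}))) \<le>
        (wt (m k) (?A k) + wt (m k) (?A k - {i})) * exp (if 0 < m k \<and> m k < N then ?c else 0)"
      using column_upper_tail[OF A[OF k] labelsD[OF m(1) k] r[OF k] t] A(2)[OF k] by simp
    show "0 \<le> wt (m k) (?A k) * exp (t * (r k * ?s k (?A k))) +
        wt (m k) (?A k - {i}) * exp (t * (r k * ?s k (?A k - {i})))"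
      using labelsD[OF m(1) k] by (intro add_nonneg_nonneg mult_nonneg_nonneg wt_nonneg) auto
  qed auto
  also have "\<dots> = exp (?c * inner_count K m - t * \<tau>) * (\<Sum>Y\<in>?F. weight K m Y)"
  proof -
    have "(\<Sum>k<K. if 0 < m k \<and> m k < N then ?c else 0) = ?c * inner_count K m"
      unfolding inner_count_def sum_distrib_left by (intro sum.cong) auto
    then have e: "(\<Prod>k<K. exp (if 0 < m k \<and> m k < N then ?c else 0)) = exp (?c * inner_count K m)"
      by (simp only: exp_sum[OF finite_lessThan, symmetric])
    show ?thesis
      unfolding weight_def pr[of "\<lambda>k B. wt (m k) B"] prod.distrib e
      by (simp add: exp_diff exp_minus field_simps)
  qed
  also have "\<dots> \<le> exp (8 * \<eta> * K * ?c - t * \<tau>) * (\<Sum>Y\<in>?F. weight K m Y)"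
  proof (intro mult_right_mono sum_nonneg weight_nonneg[OF m(1)])
    have "0 \<le> ?c" using t N_ge by simp
    then have "?c * inner_count K m \<le> ?c * (8 * \<eta> * K)"
      using m(2) by (intro mult_left_mono) (auto simp: few_inner_def)
    then show "exp (?c * inner_count K m - t * \<tau>) \<le> exp (8 * \<eta> * K * ?c - t * \<tau>)"
      by (simp add: mult.commute)
  qed
  finally show ?thesis .
qed

section \<open>Tracing\<close>

text \<open>In a book of positive weight every padding label yields a constant column, and at most
  \<open>8 * \<eta> * K\<close> labels are inner. This is what lets accuracy be invoked.\<close>

lemma few_inner_marked:
  assumes "m \<in> labels K" "few_inner K m" "Z \<in> books K" "weight K m Z \<noteq> 0"
  shows "(1 - 8 * \<eta>) * real K \<le> real (card {k. k < K \<and> (Z k = {} \<or> Z k = {..<n})})"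
proof -
  let ?M = "{k. k < K \<and> (Z k = {} \<or> Z k = {..<n})}"
  have marked: "Z k = {} \<or> Z k = {..<n}" if k: "k < K" "m k = 0 \<or> m k = N" for k
  proof -
    have A: "Z k \<subseteq> {..<n}" using booksD[OF assms(3) k(1)] .
    have "wt (m k) (Z k) \<noteq> 0" using assms(4) k(1) by (auto simp: weight_def)
    with wt_boundary_score[OF A k(2)] have "real (card (Z k)) = real n * m k / N" by simp
    then have "card (Z k) = 0 \<or> card (Z k) = n" using k(2) N_ge_2 by auto
    then show ?thesis
      using card_subset_eq[OF _ A] finite_subset[OF A] by auto
  qed
  have "real K = (\<Sum>k<K. 1)" by simp
  also have "\<dots> \<le> (\<Sum>k<K. (if k \<in> ?M then 1 else 0) + (if 0 < m k \<and> m k < N then 1 else 0))"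
  proof (intro sum_mono)
    fix k assume "k \<in> {..<K}"
    then have k: "k < K" by simp
    show "(1::real) \<le> (if k \<in> ?M then 1 else 0) + (if 0 < m k \<and> m k < N then 1 else 0)"
      using marked[OF k] labelsD[OF assms(1) k] k by auto
  qed
  also have "\<dots> = real (card ?M) + inner_count K m"
  proof -
    have "{..<K} \<inter> {k. Z k = {} \<or> Z k = {..<n}} = ?M" by auto
    then show ?thesis by (simp add: sum.distrib inner_count_def sum.If_cases)
  qed
  also have "\<dots> \<le> real (card ?M) + 8 * \<eta> * real K"
    using assms(2) by (simp add: few_inner_def)
  finally show ?thesis by (simp add: algebra_simps)
qed

lemma sum_weight_few_le: "(\<Sum>m\<in>{m\<in>labels K. few_inner K m}. \<Sum>Z\<in>books K. weight K m Z) \<le> 1"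
proof -
  have "(\<Sum>m\<in>{m\<in>labels K. few_inner K m}. \<Sum>Z\<in>books K. weight K m Z) \<le>
      (\<Sum>m\<in>labels K. \<Sum>Z\<in>books K. weight K m Z)"
    by (intro sum_mono2 finite_labels sum_nonneg weight_nonneg) auto
  also have "\<dots> = 1" by (simp add: sum_weight_books sum_prior_labels)
  finally show ?thesis .
qed

lemma score_measurable:
  assumes "\<And>k. k < K \<Longrightarrow> (\<lambda>q. r q k) \<in> borel_measurable Q"
  shows "(\<lambda>q. score K m Z (r q) i) \<in> borel_measurable Q"
  unfolding score_def using assms by (intro borel_measurable_sum borel_measurable_times) auto

text \<open>The accounting. Agreeing answers have mass at least \<open>7/8 * \<beta>\<close>. Each
  comes with a low total score, of mass at most \<open>\<beta> / 8\<close>, or with a user above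
  \<open>\<tau>\<close>, of mass at most \<open>\<beta> / 8 + \<beta> / 4\<close> by privacy and a
  union bound over users. The sum is only \<open>\<beta> / 2\<close>.\<close>

lemma tracing_contradiction:
  fixes \<nu> :: "(nat \<Rightarrow> nat set) \<Rightarrow> 'q measure" and Q :: "'q measure" and r :: "'q \<Rightarrow> nat \<Rightarrow> real"
  assumes prob: "\<And>Z. Z \<in> books K \<Longrightarrow> prob_space (\<nu> Z)"
    and sets: "\<And>Z. Z \<in> books K \<Longrightarrow> sets (\<nu> Z) = sets Q"
    and r_meas: "\<And>k. k < K \<Longrightarrow> (\<lambda>q. r q k) \<in> borel_measurable Q"
    and r_bd: "\<And>k q. k < K \<Longrightarrow> q \<in> space Q \<Longrightarrow> \<bar>r q k\<bar> \<le> 1"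
    and privacy: "\<And>Z i T. Z \<in> books K \<Longrightarrow> i < n \<Longrightarrow> T \<in> sets Q \<Longrightarrow>
        measure (\<nu> Z) T \<le> exp 1 * measure (\<nu> (fill_row K i Z)) T + \<beta> / (4 * real n)"
    and accurate: "\<And>Z. Z \<in> books K \<Longrightarrow>
        (1 - 8 * \<eta>) * real K \<le> real (card {k. k < K \<and> (Z k = {} \<or> Z k = {..<n})}) \<Longrightarrow>
        \<beta> \<le> measure (\<nu> Z) {q \<in> space Q. 3 / 10 * real K \<le> correlation K Z (r q)}"
    and beta: "0 < \<beta>" and D: "0 < D" "D \<le> signal" "D \<le> 1 / 2"
    and few: "exp (- 6 * \<eta> * real K) \<le> 1 / 8"
    and main: "exp 1 * real n * exp (- (\<eta> * real K * D\<^sup>2 / (12500 * (real n)\<^sup>2))) \<le> \<beta> / 8"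
    and N_large: "16 * real n / (real N - real n) \<le> 3 / 80 * (D / real n)"
  shows False
proof -
  define L where "L = {m\<in>labels K. few_inner K m}"
  \<comment> \<open>Both tails decay exponentially in \<open>x\<close>, at rates
    \<open>7 / 80000\<close> and \<open>13 / 160000\<close>; the rate \<open>1 / 12500\<close> used
    below is smaller than both.\<close>
  define x where "x = \<eta> * real K * D\<^sup>2 / (real n)\<^sup>2"
  \<comment> \<open>Half of the per-user share of \<open>3/10 * \<eta> * K * D\<close>, the drift
    guaranteed by a correlated answer, so that both tails have a gap.\<close>
  define \<tau> where "\<tau> = 3 / 20 * (\<eta> * real K * D / real n)"
  define A where "A Z = {q \<in> space Q. 3 / 10 * real K \<le> correlation K Z (r q)}" for Z
  define E where "E m Z i = {q \<in> space Q. \<tau> < score K m Z (r q) i}" for m Z i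
  define B where "B m Z = {q \<in> A Z. (\<Sum>i<n. score K m Z (r q) i) \<le> real n * \<tau>}" for m Z
  have n1: "1 \<le> real n" using n_pos by simp
  have x0: "0 \<le> x" using eta D by (simp add: x_def)
  have mx: "exp 1 * real n * exp (- (x / 12500)) \<le> \<beta> / 8"
    using main by (simp add: x_def mult.commute[of _ 12500])
  have L: "m \<in> labels K" "few_inner K m" if "m \<in> L" for m using that by (auto simp: L_def)
  have sp: "space (\<nu> Z) = space Q" if "Z \<in> books K" for Z
    using sets[OF that] by (rule sets_eq_imp_space_eq)
  have A_sets: "A Z \<in> sets Q" for Z
    unfolding A_def correlation_def using r_meas
    by (intro borel_measurable_le borel_measurable_const borel_measurable_sum borel_measurable_times) auto
  have E_sets: "E m Z i \<in> sets Q" for m Z i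
    unfolding E_def using score_measurable[OF r_meas]
    by (intro borel_measurable_less borel_measurable_const) auto
  have B_sets: "B m Z \<in> sets Q" for m Z
  proof -
    have "B m Z = A Z \<inter> {q \<in> space Q. (\<Sum>i<n. score K m Z (r q) i) \<le> real n * \<tau>}"
      by (auto simp: B_def A_def)
    also have "\<dots> \<in> sets Q"
      using score_measurable[OF r_meas]
      by (intro sets.Int A_sets borel_measurable_le borel_measurable_const borel_measurable_sum) auto
    finally show ?thesis .
  qed

  have agree: "7 / 8 * \<beta> \<le> (\<Sum>m\<in>L. \<Sum>Z\<in>books K. weight K m Z * measure (\<nu> Z) (A Z))"
  proof -
    have "7 / 8 * \<beta> \<le> (\<Sum>m\<in>L. \<Sum>Z\<in>books K. weight K m Z) * \<beta>"
      using few_inner_prob[OF few] beta unfolding L_def by (intro mult_right_mono) auto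
    also have "\<dots> \<le> (\<Sum>m\<in>L. \<Sum>Z\<in>books K. weight K m Z * measure (\<nu> Z) (A Z))"
      unfolding sum_distrib_right
    proof (intro sum_mono)
      fix m Z assume m: "m \<in> L" and Z: "Z \<in> books K"
      show "weight K m Z * \<beta> \<le> weight K m Z * measure (\<nu> Z) (A Z)"
      proof (cases "weight K m Z = 0")
        case False
        show ?thesis
          unfolding A_def using L[OF m] False Z
          by (intro mult_left_mono accurate few_inner_marked[of m] weight_nonneg)
      qed simp
    qed
    finally show ?thesis .
  qed

  have untraced: "(\<Sum>m\<in>L. \<Sum>Z\<in>books K. weight K m Z * measure (\<nu> Z) (B m Z)) \<le> \<beta> / 8"
  proof -
    \<comment> \<open>Close to the minimiser of
      \<open>64 t^2 n^2 \<eta> K - 3/20 t \<eta> D K\<close>, the exponent after inserting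
      \<open>\<tau>\<close>.\<close>
    define t where "t = D / (800 * (real n)\<^sup>2)"
    have t0: "0 \<le> t" using D by (simp add: t_def)
    have t1: "2 * real n * t \<le> 1 / 2"
    proof -
      have "2 * real n * t = D / (400 * real n)" using n1 by (simp add: t_def power2_eq_square)
      also have "\<dots> \<le> (1/2) / (400 * 1)" using D n1 by (intro frac_le) auto
      finally show ?thesis by simp
    qed
    let ?e = "exp (t * (real n * \<tau>) + 64 * t\<^sup>2 * (real n)\<^sup>2 * \<eta> * K - t * (\<eta> * D * (3 / 10 * real K)))"
    have e: "?e = exp (- (7 / 80000 * x))"
      unfolding t_def \<tau>_def x_def using n1
      by (simp add: field_simps power2_eq_square)
    \<comment> \<open>The answer depends on the book but not on the labels, so for each book the
      labels can be averaged with the answer fixed.\<close>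
    have "(\<Sum>m\<in>L. \<Sum>Z\<in>books K. weight K m Z * measure (\<nu> Z) (B m Z)) =
        (\<Sum>Z\<in>books K. \<Sum>m\<in>L. weight K m Z * measure (\<nu> Z) (B m Z))"
      by (rule sum.swap)
    also have "\<dots> \<le> (\<Sum>Z\<in>books K. ?e * (\<Prod>k<K. marg (Z k)))"
    proof (intro sum_mono)
      fix Z assume Z: "Z \<in> books K"
      interpret prob_space "\<nu> Z" by (rule prob[OF Z])
      show "(\<Sum>m\<in>L. weight K m Z * measure (\<nu> Z) (B m Z)) \<le> ?e * (\<Prod>k<K. marg (Z k))"
      proof (rule weighted_prob_le)
        show "finite L" unfolding L_def using finite_labels by simp
        show "B m Z \<in> events" for m using B_sets sets[OF Z] by simp
        fix q assume "q \<in> space (\<nu> Z)"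
        then have q: "q \<in> space Q" using sp[OF Z] by simp
        show "(\<Sum>m\<in>L. weight K m Z * (if q \<in> B m Z then 1 else 0)) \<le> ?e * (\<Prod>k<K. marg (Z k))"
        proof (cases "q \<in> A Z")
          case True
          then have "(\<Sum>m\<in>L. weight K m Z * (if q \<in> B m Z then 1 else 0)) =
             (\<Sum>m\<in>L. weight K m Z * (if (\<Sum>i<n. score K m Z (r q) i) \<le> real n * \<tau> then 1 else 0))"
            by (intro sum.cong) (auto simp: B_def)
          also have "\<dots> \<le> ?e * (\<Prod>k<K. marg (Z k))"
            unfolding L_def using True D q
            by (intro book_lower_tail Z r_bd t0 t1) (auto simp: A_def)
          finally show ?thesis .
        next
          case False
          then show ?thesis by (auto simp: B_def intro!: mult_nonneg_nonneg prod_nonneg marg_nonneg)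
        qed
      qed
    qed
    also have "\<dots> = exp (- (7 / 80000 * x))"
      unfolding sum_distrib_left[symmetric] sum_marg_books e by simp
    also have "\<dots> \<le> 1 * exp (- (x / 12500))" using x0 by simp
    also have "\<dots> \<le> (exp 1 * real n) * exp (- (x / 12500))"
      using n1 mult_mono[of 1 "exp 1" 1 "real n"] by (intro mult_right_mono) auto
    also have "\<dots> \<le> \<beta> / 8" by (rule mx)
    finally show ?thesis .
  qed

  have innocent: "(\<Sum>m\<in>L. \<Sum>Z\<in>books K. weight K m Z * measure (\<nu> (fill_row K i Z)) (E m Z i)) \<le>
      exp (- (x / 12500))" if i: "i < n" for i
  proof -
    \<comment> \<open>Small enough for the quadratic term \<open>32 t^2 \<eta> K\<close> to stay
      below the linear gain; by \<open>N_large\<close> the sampling error uses up at most a quarter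
      of \<open>\<tau>\<close>.\<close>
    define t where "t = D / (400 * real n)"
    have t0: "0 \<le> t" using D by (simp add: t_def)
    have t1: "t \<le> 1 / 2"
    proof -
      have "t \<le> (1/2) / (400 * 1)" unfolding t_def using D n1 by (intro frac_le) auto
      then show ?thesis by simp
    qed
    let ?e = "exp (8 * \<eta> * K * (t * (2 * real n / (real N - real n)) + 4 * t\<^sup>2) - t * \<tau>)"
    have e: "?e \<le> exp (- (x / 12500))"
    proof -
      have "8 * \<eta> * K * (t * (2 * real n / (real N - real n)) + 4 * t\<^sup>2) =
          \<eta> * K * t * (16 * real n / (real N - real n)) + 32 * t\<^sup>2 * (\<eta> * K)"
        by (simp add: algebra_simps)
      also have "\<dots> \<le> \<eta> * K * t * (3 / 80 * (D / real n)) + 32 * t\<^sup>2 * (\<eta> * K)"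
        using N_large t0 eta by (intro add_right_mono mult_left_mono) auto
      also have "\<dots> - t * \<tau> = - (13 / 160000 * x)"
        unfolding t_def \<tau>_def x_def using n1 by (simp add: field_simps power2_eq_square)
      finally show ?thesis using x0 by simp
    qed
    have row: "(\<Sum>Z\<in>books K. weight K m Z * measure (\<nu> (fill_row K i Z)) (E m Z i)) \<le>
       ?e * (\<Sum>Z\<in>books K. weight K m Z)" if m: "m \<in> L" for m
    proof -
      \<comment> \<open>On a fibre of \<open>fill_row\<close> the answer distribution is constant,
        hence unaffected by the erased row.\<close>
      let ?fib = "\<lambda>Y. {Z \<in> books K. fill_row K i Z = Y}"
      have "(\<Sum>Z\<in>books K. weight K m Z * measure (\<nu> (fill_row K i Z)) (E m Z i)) =
         (\<Sum>Y\<in>fill_row K i ` books K. \<Sum>Z\<in>?fib Y. weight K m Z * measure (\<nu> (fill_row K i Z)) (E m Z i))"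
        using finite_books by (subst sum.group) auto
      also have "\<dots> \<le> (\<Sum>Y\<in>fill_row K i ` books K. ?e * (\<Sum>Z\<in>?fib Y. weight K m Z))"
      proof (intro sum_mono)
        fix Y assume "Y \<in> fill_row K i ` books K"
        then obtain Z0 where Z0: "Z0 \<in> books K" and Y: "Y = fill_row K i Z0" by auto
        have Yb: "Y \<in> books K" unfolding Y by (rule fill_row_books[OF Z0 i])
        interpret prob_space "\<nu> Y" by (rule prob[OF Yb])
        have "(\<Sum>Z\<in>?fib Y. weight K m Z * measure (\<nu> (fill_row K i Z)) (E m Z i)) =
            (\<Sum>Z\<in>?fib Y. weight K m Z * measure (\<nu> Y) (E m Z i))"
          by (intro sum.cong) auto
        also have "\<dots> \<le> ?e * (\<Sum>Z\<in>?fib Y. weight K m Z)"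
        proof (rule weighted_prob_le)
          show "finite (?fib Y)" using finite_books by simp
          show "E m Z i \<in> events" for Z using E_sets sets[OF Yb] by simp
          fix q assume "q \<in> space (\<nu> Y)"
          then have q: "q \<in> space Q" using sp[OF Yb] by simp
          then show "(\<Sum>Z\<in>?fib Y. weight K m Z * (if q \<in> E m Z i then 1 else 0)) \<le>
              ?e * (\<Sum>Z\<in>?fib Y. weight K m Z)"
            using row_upper_tail[OF Z0 i L[OF m] r_bd[OF _ q] t0 t1, where \<tau> = \<tau>]
            unfolding Y E_def by simp
        qed
        finally show "(\<Sum>Z\<in>?fib Y. weight K m Z * measure (\<nu> (fill_row K i Z)) (E m Z i)) \<le>
            ?e * (\<Sum>Z\<in>?fib Y. weight K m Z)" .
      qed
      also have "\<dots> = ?e * (\<Sum>Z\<in>books K. weight K m Z)"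
        unfolding sum_distrib_left[symmetric] using finite_books by (subst sum.group) auto
      finally show ?thesis .
    qed
    have "(\<Sum>m\<in>L. \<Sum>Z\<in>books K. weight K m Z * measure (\<nu> (fill_row K i Z)) (E m Z i)) \<le>
        ?e * (\<Sum>m\<in>L. \<Sum>Z\<in>books K. weight K m Z)"
      unfolding sum_distrib_left[of _ _ L] by (intro sum_mono row)
    also have "\<dots> \<le> exp (- (x / 12500)) * 1"
      using e sum_weight_few_le unfolding L_def
      by (intro mult_mono sum_nonneg weight_nonneg) auto
    finally show ?thesis by simp
  qed

  have traced: "(\<Sum>m\<in>L. \<Sum>Z\<in>books K. weight K m Z * measure (\<nu> Z) (E m Z i)) \<le>
      exp 1 * exp (- (x / 12500)) + \<beta> / (4 * real n)" if i: "i < n" for i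
  proof -
    have "(\<Sum>m\<in>L. \<Sum>Z\<in>books K. weight K m Z * measure (\<nu> Z) (E m Z i)) \<le>
       (\<Sum>m\<in>L. \<Sum>Z\<in>books K. weight K m Z * (exp 1 * measure (\<nu> (fill_row K i Z)) (E m Z i) + \<beta> / (4 * real n)))"
      using L E_sets i by (intro sum_mono mult_left_mono privacy weight_nonneg) auto
    also have "\<dots> = exp 1 * (\<Sum>m\<in>L. \<Sum>Z\<in>books K. weight K m Z * measure (\<nu> (fill_row K i Z)) (E m Z i)) +
       (\<Sum>m\<in>L. \<Sum>Z\<in>books K. weight K m Z) * (\<beta> / (4 * real n))"
      by (simp only: distrib_left sum.distrib sum_distrib_left sum_distrib_right mult_ac)
    also have "\<dots> \<le> exp 1 * exp (- (x / 12500)) + 1 * (\<beta> / (4 * real n))"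
      using innocent[OF i] sum_weight_few_le beta unfolding L_def
      by (intro add_mono mult_left_mono mult_right_mono) auto
    finally show ?thesis by simp
  qed

  have union: "measure (\<nu> Z) (A Z) \<le> measure (\<nu> Z) (B m Z) + (\<Sum>i<n. measure (\<nu> Z) (E m Z i))"
    if Z: "Z \<in> books K" for m Z
  proof -
    interpret prob_space "\<nu> Z" by (rule prob[OF Z])
    \<comment> \<open>If no user exceeds \<open>\<tau>\<close>, the total is at most
      \<open>n * \<tau>\<close>, which puts the answer in \<open>B m Z\<close>.\<close>
    have "A Z \<subseteq> B m Z \<union> (\<Union>i<n. E m Z i)"
    proof
      fix q assume q: "q \<in> A Z"
      show "q \<in> B m Z \<union> (\<Union>i<n. E m Z i)"
      proof (rule ccontr)
        assume c: "q \<notin> B m Z \<union> (\<Union>i<n. E m Z i)"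
        then have "(\<Sum>i<n. score K m Z (r q) i) \<le> (\<Sum>i<n. \<tau>)"
          using q by (intro sum_mono) (auto simp: A_def E_def not_less)
        with c q show False by (auto simp: B_def)
      qed
    qed
    then have "prob (A Z) \<le> prob (B m Z \<union> (\<Union>i<n. E m Z i))"
      using B_sets E_sets sets[OF Z] by (intro finite_measure_mono) auto
    also have "\<dots> \<le> prob (B m Z) + prob (\<Union>i<n. E m Z i)"
      using B_sets E_sets sets[OF Z] by (intro measure_Un_le) auto
    also have "prob (\<Union>i<n. E m Z i) \<le> (\<Sum>i<n. prob (E m Z i))"
      using E_sets sets[OF Z] by (intro finite_measure_subadditive_finite) auto
    finally show ?thesis by simp
  qed

  have "7 / 8 * \<beta> \<le> (\<Sum>m\<in>L. \<Sum>Z\<in>books K. weight K m Z * measure (\<nu> Z) (A Z))"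
    by (rule agree)
  also have "\<dots> \<le> (\<Sum>m\<in>L. \<Sum>Z\<in>books K. weight K m Z *
      (measure (\<nu> Z) (B m Z) + (\<Sum>i<n. measure (\<nu> Z) (E m Z i))))"
    using L by (intro sum_mono mult_left_mono union weight_nonneg) auto
  also have "\<dots> = (\<Sum>m\<in>L. \<Sum>Z\<in>books K. weight K m Z * measure (\<nu> Z) (B m Z)) +
      (\<Sum>m\<in>L. \<Sum>Z\<in>books K. \<Sum>i<n. weight K m Z * measure (\<nu> Z) (E m Z i))"
    by (simp only: distrib_left sum.distrib sum_distrib_left)
  also have "(\<Sum>m\<in>L. \<Sum>Z\<in>books K. \<Sum>i<n. weight K m Z * measure (\<nu> Z) (E m Z i)) =
      (\<Sum>i<n. \<Sum>m\<in>L. \<Sum>Z\<in>books K. weight K m Z * measure (\<nu> Z) (E m Z i))"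
    by (subst sum.swap[of _ _ "books K"], rule sum.swap)
  also have "(\<Sum>m\<in>L. \<Sum>Z\<in>books K. weight K m Z * measure (\<nu> Z) (B m Z)) + \<dots> \<le>
      \<beta> / 8 + (\<Sum>i<n. exp 1 * exp (- (x / 12500)) + \<beta> / (4 * real n))"
    using traced by (intro add_mono untraced sum_mono) auto
  also have "\<dots> = \<beta> / 8 + exp 1 * real n * exp (- (x / 12500)) + \<beta> / 4"
    using n1 by (simp add: field_simps)
  also have "\<dots> \<le> \<beta> / 2" using mx by simp
  finally show False using beta by simp
qed

end

section \<open>Datasets built from codebooks\<close>

text \<open>A coordinate equal to \<open>b\<close> contributes 1 and any other at least -1.\<close>

lemma sum_agreement_ge:
  fixes q :: "nat \<Rightarrow> real"
  assumes "finite J" "\<And>j. j \<in> J \<Longrightarrow> \<bar>q j\<bar> \<le> 1" "b = 1 \<or> b = -1"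
  shows "2 * real (card {j \<in> J. q j = b}) - real (card J) \<le> (\<Sum>j\<in>J. b * q j)"
proof -
  have "2 * real (card {j \<in> J. q j = b}) - real (card J) = (\<Sum>j\<in>J. 2 * (if q j = b then 1 else 0) - 1)"
    using assms(1) by (simp add: sum_subtractf sum_distrib_left[symmetric] sum.If_cases Int_def)
  also have "\<dots> \<le> (\<Sum>j\<in>J. b * q j)"
  proof (intro sum_mono)
    fix j assume "j \<in> J"
    then have "\<bar>q j\<bar> \<le> 1" by (rule assms(2))
    then show "2 * (if q j = b then 1 else 0) - 1 \<le> b * q j"
      using assms(3) by auto
  qed
  finally show ?thesis .
qed

lemma component_measurable_out_space:
  assumes "j < d"
  shows "(\<lambda>q. q j) \<in> borel_measurable (out_space d)"
proof -
  have "(\<lambda>q. q j) \<in> measurable (out_space d) (restrict_space borel {-1..1})"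
    unfolding out_space_def using assms by (intro measurable_component_singleton) simp
  then show ?thesis by (simp add: measurable_restrict_space2_iff)
qed

lemma space_out_space: "q \<in> space (out_space d) \<Longrightarrow> j < d \<Longrightarrow> \<bar>q j\<bar> \<le> 1"
  by (auto simp: out_space_def space_PiM PiE_iff space_restrict_space abs_le_iff)

text \<open>Each codeword column occupies one column \<open>k\<close> and appears negated in column \<open>d div 2 + k\<close>,
  so the numbers of \<open>1\<close>-marked and \<open>-1\<close>-marked columns agree exactly
  up to the constant last column of an odd \<open>d\<close>.\<close>

definition book_data :: "nat \<Rightarrow> nat \<Rightarrow> (nat \<Rightarrow> nat set) \<Rightarrow> nat \<Rightarrow> nat \<Rightarrow> real" where
  "book_data n d Z i j =
     (if i < n \<and> j < d
      then if j < d div 2 then if i \<in> Z j then 1 else -1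
           else if j < 2 * (d div 2) then if i \<in> Z (j - d div 2) then -1 else 1
           else 1
      else 0)"

text \<open>Combines both copies of a codeword column into one answer that stays in [-1,1].\<close>

definition answer :: "nat \<Rightarrow> (nat \<Rightarrow> real) \<Rightarrow> nat \<Rightarrow> real" where
  "answer d q k = (q k - q (d div 2 + k)) / 2"

lemma dataset_book_data: "dataset n d (book_data n d Z)"
  by (auto simp: dataset_def book_data_def)

lemma answer_measurable: "k < d div 2 \<Longrightarrow> (\<lambda>q. answer d q k) \<in> borel_measurable (out_space d)"
  unfolding answer_def
  by (intro borel_measurable_divide borel_measurable_diff component_measurable_out_space borel_measurable_const) auto

lemma abs_answer_le: "q \<in> space (out_space d) \<Longrightarrow> k < d div 2 \<Longrightarrow> \<bar>answer d q k\<bar> \<le> 1"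
  using space_out_space[of q d k] space_out_space[of q d "d div 2 + k"]
  by (force simp: answer_def abs_le_iff)

context hypergeometric_code
begin

text \<open>The second alternative covers a row that overwriting leaves unchanged, since
  \<open>neighbors\<close> requires a genuine difference.\<close>

lemma book_data_fill_row:
  assumes "i < n"
  shows "neighbors n d (book_data n d Z) (book_data n d (fill_row (d div 2) i Z)) \<or>
    book_data n d Z = book_data n d (fill_row (d div 2) i Z)"
proof -
  let ?X = "book_data n d Z" and ?X' = "book_data n d (fill_row (d div 2) i Z)"
  have eq: "?X i' j = ?X' i' j" if "i' \<noteq> i" for i' j
    using that by (auto simp: book_data_def fill_row_def)
  have out: "?X i' j = ?X' i' j" if "\<not> (i' < n \<and> j < d)" for i' j
    using that by (auto simp: book_data_def)
  show ?thesis
  proof (cases "\<exists>j<d. ?X i j \<noteq> ?X' i j")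
    case True
    then have "{i'. i' < n \<and> (\<exists>j<d. ?X i' j \<noteq> ?X' i' j)} = {i}"
      using assms eq by blast
    then show ?thesis by (simp add: neighbors_def)
  next
    case False
    have "?X i' j = ?X' i' j" for i' j
      using False eq[of i' j] out[of i' j] by blast
    then show ?thesis by blast
  qed
qed

context
  fixes d :: nat and Z :: "nat \<Rightarrow> nat set"
  assumes Z: "Z \<in> books (d div 2)"
begin

private abbreviation "U \<equiv> {k. k < d div 2 \<and> Z k = {..<n}}"
private abbreviation "V \<equiv> {k. k < d div 2 \<and> Z k = {}}"

lemma full_iff: "k < d div 2 \<Longrightarrow> Z k = {..<n} \<longleftrightarrow> (\<forall>i<n. i \<in> Z k)"
  using booksD[OF Z] by blast

lemma empty_iff: "k < d div 2 \<Longrightarrow> Z k = {} \<longleftrightarrow> (\<forall>i<n. i \<notin> Z k)"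
  using booksD[OF Z] by blast

lemma marked_neg: "marked n d (book_data n d Z) (-1) = V \<union> (+) (d div 2) ` U"
proof (intro set_eqI)
  fix j
  consider "j < d div 2" | "d div 2 \<le> j" "j < 2 * (d div 2)" | "2 * (d div 2) \<le> j" by linarith
  then show "j \<in> marked n d (book_data n d Z) (-1) \<longleftrightarrow> j \<in> V \<union> (+) (d div 2) ` U"
  proof cases
    case 1
    then have "j < d" by simp
    with 1 show ?thesis by (auto simp: marked_def book_data_def empty_iff)
  next
    case 2
    then obtain k where k: "j = d div 2 + k" "k < d div 2"
      by (metis le_Suc_ex mult_2 nat_add_left_cancel_less)
    then have "j < d" by simp
    with k show ?thesis
      by (auto simp: marked_def book_data_def full_iff inj_image_mem_iff[OF inj_on_add])
  next
    case 3
    \<comment> \<open>Beyond the two copies the entries are 1 or 0; row 0 exists because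
      \<open>n\<close> is positive.\<close>
    then have "book_data n d Z 0 j \<noteq> -1" by (simp add: book_data_def)
    then have "j \<notin> marked n d (book_data n d Z) (-1)" using n_pos by (force simp: marked_def)
    moreover have "j \<notin> V \<union> (+) (d div 2) ` U"
    proof
      assume "j \<in> V \<union> (+) (d div 2) ` U"
      then have "j < d div 2 + d div 2" by (elim UnE imageE) auto
      with 3 show False by simp
    qed
    ultimately show ?thesis by blast
  qed
qed

lemma marked_pos: "marked n d (book_data n d Z) 1 = (U \<union> (+) (d div 2) ` V) \<union> {2 * (d div 2)..<d}"
proof (intro set_eqI)
  fix j
  consider "j < d div 2" | "d div 2 \<le> j" "j < 2 * (d div 2)" | "2 * (d div 2) \<le> j" by linarith
  then show "j \<in> marked n d (book_data n d Z) 1 \<longleftrightarrow> j \<in> (U \<union> (+) (d div 2) ` V) \<union> {2 * (d div 2)..<d}"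
  proof cases
    case 1
    then have "j < d" by simp
    with 1 show ?thesis by (auto simp: marked_def book_data_def full_iff)
  next
    case 2
    then obtain k where k: "j = d div 2 + k" "k < d div 2"
      by (metis le_Suc_ex mult_2 nat_add_left_cancel_less)
    then have "j < d" by simp
    with k show ?thesis
      by (auto simp: marked_def book_data_def empty_iff inj_image_mem_iff[OF inj_on_add])
  next
    case 3
    then show ?thesis by (auto simp: marked_def book_data_def)
  qed
qed

text \<open>Negation exchanges full and empty columns, so each marked codeword column yields one
  marked column of either sign.\<close>

lemma card_marked_part:
  "card {k. k < d div 2 \<and> (Z k = {} \<or> Z k = {..<n})} = card U + card V"
  "card (U \<union> (+) (d div 2) ` V) = card U + card V"
  "card (V \<union> (+) (d div 2) ` U) = card U + card V"
proof -
  have "{k. k < d div 2 \<and> (Z k = {} \<or> Z k = {..<n})} = U \<union> V" by auto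
  moreover have "U \<inter> V = {}" using empty_ne_full by auto
  ultimately show "card {k. k < d div 2 \<and> (Z k = {} \<or> Z k = {..<n})} = card U + card V"
    by (simp add: card_Un_disjoint)
  show "card (U \<union> (+) (d div 2) ` V) = card U + card V"
    by (subst card_Un_disjoint) (auto simp: card_image)
  show "card (V \<union> (+) (d div 2) ` U) = card U + card V"
    by (subst card_Un_disjoint) (auto simp: card_image)
qed

lemma card_marked_ge:
  assumes "b = 1 \<or> b = -1"
  shows "card {k. k < d div 2 \<and> (Z k = {} \<or> Z k = {..<n})} \<le> card (marked n d (book_data n d Z) b)"
  using assms
proof
  assume "b = 1"
  then show ?thesis
    unfolding card_marked_part(1) card_marked_part(2)[symmetric] using marked_pos
    by (auto intro!: card_mono)
next
  assume "b = -1"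
  then show ?thesis by (simp add: card_marked_part marked_neg)
qed

text \<open>Regrouping by the sign of the mark: the sums run over the paired columns marked 1 and
  -1, without the spare column of an odd \<open>d\<close>.\<close>

lemma correlation_eq:
  "2 * correlation (d div 2) Z (answer d q) =
    (\<Sum>j\<in>U \<union> (+) (d div 2) ` V. 1 * q j) + (\<Sum>j\<in>V \<union> (+) (d div 2) ` U. -1 * q j)"
proof -
  have "correlation (d div 2) Z (answer d q) =
     (\<Sum>k<d div 2. (if Z k = {..<n} then answer d q k else 0) - (if Z k = {} then answer d q k else 0))"
    unfolding correlation_def using empty_ne_full by (intro sum.cong) (auto simp: marksign_def)
  also have "\<dots> = (\<Sum>k\<in>U. answer d q k) - (\<Sum>k\<in>V. answer d q k)"
    unfolding sum_subtractf by (simp add: sum.inter_filter[symmetric])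
  finally have c: "correlation (d div 2) Z (answer d q) = (\<Sum>k\<in>U. answer d q k) - (\<Sum>k\<in>V. answer d q k)" .
  have a: "2 * (\<Sum>k\<in>S. answer d q k) = (\<Sum>k\<in>S. q k) - (\<Sum>k\<in>S. q (d div 2 + k))" for S
    unfolding sum_distrib_left sum_subtractf[symmetric] by (intro sum.cong) (auto simp: answer_def)
  have s: "(\<Sum>j\<in>S \<union> (+) (d div 2) ` T. f j) = (\<Sum>k\<in>S. f k) + (\<Sum>k\<in>T. f (d div 2 + k))"
    if "S \<subseteq> {..<d div 2}" "T \<subseteq> {..<d div 2}" for S T and f :: "nat \<Rightarrow> real"
  proof -
    have "finite S" "finite T" using that finite_subset by blast+
    moreover have "S \<inter> (+) (d div 2) ` T = {}" using that by auto
    ultimately show ?thesis by (simp add: sum.union_disjoint sum.reindex)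
  qed
  show ?thesis
    unfolding c right_diff_distrib a
    by (subst (1 2) s) (auto simp: sum_negf)
qed

text \<open>With \<open>c\<close> marked codeword columns, agreement on nine tenths gives each sign
  a sum of at least \<open>0.8 c\<close>, less 0.2 for the spare column. The correlation is thus at
  least \<open>0.8 c - 0.1\<close>, and \<open>c \<ge> K / 2\<close> with \<open>K \<ge> 1\<close>,
  where \<open>K\<close> is \<open>d div 2\<close>, leaves \<open>3/10 K\<close>.\<close>

lemma agrees_imp_correlation:
  assumes q: "q \<in> space (out_space d)" and agree: "strongly_agrees n d q (book_data n d Z)"
    and d: "2 \<le> d" and half: "real (d div 2) / 2 \<le> real (card {k. k < d div 2 \<and> (Z k = {} \<or> Z k = {..<n})})"
  shows "3 / 10 * real (d div 2) \<le> correlation (d div 2) Z (answer d q)"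
proof -
  define J J' where "J = U \<union> (+) (d div 2) ` V" and "J' = V \<union> (+) (d div 2) ` U"
  define R where "R = {2 * (d div 2)..<d}"
  define c where "c = real (card U + card V)"
  have c: "card J = c" "card J' = c" by (simp_all only: card_marked_part c_def J_def J'_def)
  have fin: "finite J" "finite J'" "finite R" by (auto simp: J_def J'_def R_def)
  have "j < d div 2 + d div 2" if "j \<in> J \<union> J'" for j
    using that unfolding J_def J'_def by (elim UnE imageE) auto
  then have Jd: "j < 2 * (d div 2)" if "j \<in> J \<union> J'" for j using that by (simp add: mult_2)
  have b: "\<bar>q j\<bar> \<le> 1" if "j \<in> J \<union> J'" for j
  proof (rule space_out_space[OF q])
    show "j < d" using Jd[OF that] by linarith
  qed
  have R1: "card R \<le> 1" by (simp add: R_def)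
  have "J \<inter> R = {}" using Jd by (fastforce simp: R_def)
  then have "card (J \<union> R) = card J + card R" using fin by (intro card_Un_disjoint)
  moreover have "card {j \<in> J \<union> R. q j = 1} \<le> card ({j \<in> J. q j = 1} \<union> R)"
    using fin by (intro card_mono) auto
  then have "card {j \<in> J \<union> R. q j = 1} \<le> card {j \<in> J. q j = 1} + card R"
    using card_Un_le[of "{j \<in> J. q j = 1}" R] by (rule order_trans)
  moreover have "0.9 * real (card (J \<union> R)) \<le> real (card {j \<in> J \<union> R. q j = 1})"
    using agree unfolding strongly_agrees_def J_def R_def marked_pos[symmetric] by blast
  \<comment> \<open>The spare column may account for one agreement:
    \<open>0.9 * (c + 1) - 1\<close>.\<close>
  ultimately have 1: "0.9 * c - 0.1 \<le> real (card {j \<in> J. q j = 1})"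
    using R1 c(1) by linarith
  have 2: "0.9 * c \<le> real (card {j \<in> J'. q j = -1})"
    using agree unfolding strongly_agrees_def c(2)[symmetric] unfolding J'_def marked_neg[symmetric] by blast
  have "2 * real (card {j \<in> J. q j = 1}) - real (card J) \<le> (\<Sum>j\<in>J. 1 * q j)"
    using b fin by (intro sum_agreement_ge) auto
  moreover have "2 * real (card {j \<in> J'. q j = -1}) - real (card J') \<le> (\<Sum>j\<in>J'. -1 * q j)"
    using b fin by (intro sum_agreement_ge) auto
  ultimately have "1.6 * c - 0.2 \<le> 2 * correlation (d div 2) Z (answer d q)"
    unfolding correlation_eq J_def[symmetric] J'_def[symmetric] using 1 2 c by linarith
  moreover have "real (d div 2) / 2 \<le> c" using half unfolding card_marked_part c_def .
  moreover have "1 \<le> d div 2" using d by linarith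
  ultimately show ?thesis by linarith
qed

end

text \<open>The choice \<open>\<eta> = \<alpha> / 16\<close> turns \<open>few_inner\<close> into a
  marked fraction of at least \<open>1 - \<alpha> / 2\<close>, twice as close to 1 as weak accuracy
  demands.\<close>

lemma no_private_accurate_mechanism:
  assumes mech: "mechanism n d M" and wacc: "weakly_accurate n d \<alpha> \<beta> M"
    and priv: "diff_private n d 1 (\<beta> / (4 * real n)) M"
    and alpha: "\<eta> = \<alpha> / 16" "\<alpha> \<le> 1" and beta: "0 < \<beta>" and ad: "2 \<le> \<alpha> * real d"
    and D: "0 < D" "D \<le> signal" "D \<le> 1 / 2"
    and few: "exp (- 6 * \<eta> * real (d div 2)) \<le> 1 / 8"
    and main: "exp 1 * real n * exp (- (\<eta> * real (d div 2) * D\<^sup>2 / (12500 * (real n)\<^sup>2))) \<le> \<beta> / 8"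
    and N_large: "16 * real n / (real N - real n) \<le> 3 / 80 * (D / real n)"
  shows False
proof -
  let ?K = "d div 2" and ?Q = "out_space d"
  let ?\<nu> = "\<lambda>Z. M (book_data n d Z)"
  have d2: "2 \<le> d"
  proof -
    have "\<alpha> * real d \<le> 1 * real d" using alpha(2) by (intro mult_right_mono) auto
    then show ?thesis using ad by simp
  qed
  have pr: "prob_space (?\<nu> Z)" "sets (?\<nu> Z) = sets ?Q" "space (?\<nu> Z) = space ?Q" for Z
    using mech dataset_book_data[of n d Z] by (auto simp: mechanism_def)
  show False
  proof (rule tracing_contradiction[of ?K ?\<nu> ?Q "answer d" \<beta> D])
    fix Z i T assume Z: "Z \<in> books ?K" and i: "i < n" and T: "T \<in> sets ?Q"
    show "measure (?\<nu> Z) T \<le> exp 1 * measure (?\<nu> (fill_row ?K i Z)) T + \<beta> / (4 * real n)"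
      using book_data_fill_row[OF i, of d Z]
    proof
      assume "neighbors n d (book_data n d Z) (book_data n d (fill_row ?K i Z))"
      then show ?thesis
        using priv T dataset_book_data unfolding diff_private_def by blast
    next
      \<comment> \<open>Equal datasets are not neighbors, but here the bound follows from
        \<open>exp 1 \<ge> 1\<close>.\<close>
      assume eq: "book_data n d Z = book_data n d (fill_row ?K i Z)"
      have "1 * measure (?\<nu> Z) T \<le> exp 1 * measure (?\<nu> Z) T"
        by (intro mult_right_mono) auto
      then show ?thesis using beta unfolding eq[symmetric] by (simp add: add_increasing2)
    qed
  next
    fix Z assume Z: "Z \<in> books ?K"
      and mk: "(1 - 8 * \<eta>) * real ?K \<le> real (card {k. k < ?K \<and> (Z k = {} \<or> Z k = {..<n})})"
    let ?mk = "real (card {k. k < ?K \<and> (Z k = {} \<or> Z k = {..<n})})"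
    \<comment> \<open>The slack \<open>\<alpha> * d / 4\<close> absorbs the column lost by rounding
      \<open>d / 2\<close> down.\<close>
    have "(1 - \<alpha>) * real d / 2 \<le> (1 - \<alpha> / 2) * ((real d - 1) / 2)"
    proof -
      have "(1 - \<alpha> / 2) * ((real d - 1) / 2) - (1 - \<alpha>) * real d / 2 = (\<alpha> * real d - 2 + \<alpha>) / 4"
        by (simp add: field_simps)
      also have "0 \<le> \<dots>" using ad alpha eta by simp
      finally show ?thesis by simp
    qed
    also have "\<dots> \<le> (1 - 8 * \<eta>) * real ?K"
    proof -
      have "d \<le> 2 * ?K + 1" by linarith
      then have "real d \<le> real (2 * ?K + 1)" by (simp only: of_nat_le_iff)
      then have "(real d - 1) / 2 \<le> real ?K" by simp
      then show ?thesis unfolding alpha(1) using alpha(2) d2 by (intro mult_mono) auto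
    qed
    also note mk
    finally have "(1 - \<alpha>) * real d / 2 \<le> ?mk" .
    then have m: "(1 - \<alpha>) * real d / 2 \<le> real (card (marked n d (book_data n d Z) b))" if "b = 1 \<or> b = -1" for b
      using card_marked_ge[OF Z that] by linarith
    have half: "real ?K / 2 \<le> ?mk"
    proof -
      have "1 / 2 * real ?K \<le> (1 - 8 * \<eta>) * real ?K"
        using alpha by (intro mult_right_mono) auto
      then show ?thesis using mk by linarith
    qed
    interpret prob_space "?\<nu> Z" by (rule pr(1))
    have "\<beta> \<le> prob {q \<in> space (?\<nu> Z). strongly_agrees n d q (book_data n d Z)}"
      using wacc m dataset_book_data unfolding weakly_accurate_def by blast
    also have "\<dots> \<le> prob {q \<in> space ?Q. 3 / 10 * real ?K \<le> correlation ?K Z (answer d q)}"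
    proof (rule finite_measure_mono)
      show "{q \<in> space (?\<nu> Z). strongly_agrees n d q (book_data n d Z)} \<subseteq>
          {q \<in> space ?Q. 3 / 10 * real ?K \<le> correlation ?K Z (answer d q)}"
        using agrees_imp_correlation[OF Z _ _ d2 half] pr(3)[of Z] by auto
      show "{q \<in> space ?Q. 3 / 10 * real ?K \<le> correlation ?K Z (answer d q)} \<in> events"
        unfolding pr(2) correlation_def using answer_measurable
        by (intro borel_measurable_le borel_measurable_const borel_measurable_sum borel_measurable_times) auto
    qed
    finally show "\<beta> \<le> measure (?\<nu> Z) {q \<in> space ?Q. 3 / 10 * real ?K \<le> correlation ?K Z (answer d q)}" .
  qed (use pr answer_measurable abs_answer_le beta D few main N_large in auto)
qed

end

section \<open>Choice of the parameters and the final bound\<close>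

lemma dimension_upper_bound:
  assumes n: "1 \<le> n" and alpha: "0 < \<alpha>" "\<alpha> \<le> 1" and beta: "0 < \<beta>" "\<beta> \<le> 1"
    and mech: "mechanism n d M" and wacc: "weakly_accurate n d \<alpha> \<beta> M"
    and priv: "diff_private n d 1 (\<beta> / (4 * real n)) M"
  shows "\<alpha> * real d < 1269600000 * (real n)\<^sup>2 * (1 + ln (real n))\<^sup>2 * (4 + ln (real n / \<beta>))"
proof (rule ccontr)
  assume "\<not> ?thesis"
  \<comment> \<open>The constant is \<open>48 * 46^2 * 12500\<close>: 48 from
    \<open>\<alpha> / 16\<close> and \<open>d div 2 \<ge> d / 3\<close>, 46 from the lower bound on
    \<open>D\<close>, 12500 from the tail exponent.\<close>
  then have big: "1269600000 * (real n)\<^sup>2 * (1 + ln (real n))\<^sup>2 * (4 + ln (real n / \<beta>)) \<le> \<alpha> * real d"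
    by simp
  \<comment> \<open>\<open>2^22 * n^4\<close> makes the sampling error negligible, while
    \<open>ln N\<close> remains of order \<open>1 + ln n\<close>.\<close>
  define N where "N = 4194304 * n ^ 4"
  define D where "D = 1 / (2 * (1 + ln (real N)))"
  define l where "l = 1 + ln (real n)"
  \<comment> \<open>The 4 covers \<open>1 + ln 8\<close>, that is, the factor \<open>exp 1\<close>
    and the 8 in \<open>\<beta> / 8\<close>.\<close>
  define lb where "lb = 4 + ln (real n / \<beta>)"
  have n1: "1 \<le> real n" using n by simp
  have l1: "1 \<le> l" using n1 by (simp add: l_def)
  have lb4: "4 \<le> lb"
    using n1 beta by (simp add: lb_def le_divide_eq)
  have nn: "n \<le> n ^ 4" using n by (simp add: self_le_power)
  have NN: "real N = (2048 * (real n)\<^sup>2)\<^sup>2" by (simp add: N_def power_mult_distrib flip: power_mult)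
  have N1: "1 \<le> real N" using nn n unfolding N_def by linarith
  have lnN: "1 + ln (real N) \<le> 23 * l"
  proof -
    have "ln (real N) = ln (2 ^ 22) + ln (real n ^ 4)"
      using n by (simp add: N_def ln_mult)
    also have "\<dots> = 22 * ln 2 + 4 * ln (real n)"
      using n by (simp only: ln_realpow)
    also have "\<dots> \<le> 22 * 1 + 4 * ln (real n)" using ln_le_minus_one[of "2::real"] by simp
    also have "\<dots> \<le> 23 * l - 1"
      using ln_ge_zero[OF n1] by (simp add: l_def distrib_left)
    finally show ?thesis by simp
  qed
  have lnN0: "1 \<le> 1 + ln (real N)" using N1 by simp
  have D: "0 < D" "D \<le> 1 / 2" using lnN0 by (auto simp: D_def field_simps)
  have Dl: "1 / (46 * l) \<le> D"
    unfolding D_def using lnN lnN0 by (intro divide_left_mono) auto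
  interpret hypergeometric_code n N "\<alpha> / 16"
    using n nn alpha by unfold_locales (auto simp: N_def)
  have ad: "5000000000 \<le> \<alpha> * real d"
  proof -
    have "1269600000 * 1 * 1 * 4 \<le> 1269600000 * (real n)\<^sup>2 * l\<^sup>2 * lb"
      using n1 l1 lb4 by (intro mult_mono) (auto simp: one_le_power)
    then show ?thesis using big by (simp add: l_def lb_def)
  qed
  have d2: "2 \<le> d"
  proof -
    have "\<alpha> * real d \<le> 1 * real d" using alpha(2) by (intro mult_right_mono) auto
    then show ?thesis using ad by simp
  qed
  then have "d \<le> 3 * (d div 2)" by linarith
  then have "real d \<le> real (3 * (d div 2))" by (simp only: of_nat_le_iff)
  then have "real d / 3 \<le> real (d div 2)" by simp
  then have K: "\<alpha> * real d / 48 \<le> \<alpha> / 16 * real (d div 2)"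
    using alpha mult_left_mono[of "real d / 3" "real (d div 2)" "\<alpha> / 16"] by simp
  have ln8: "ln 8 \<le> (3::real)"
  proof -
    have "ln (8::real) = 3 * ln 2" using ln_realpow[of "2::real" 3] by simp
    also have "\<dots> \<le> 3" using ln_le_minus_one[of "2::real"] by simp
    finally show ?thesis .
  qed
  show False
  proof (rule no_private_accurate_mechanism[OF mech wacc priv refl alpha(2) beta(1)])
    show "2 \<le> \<alpha> * real d" using ad by simp
    show "0 < D" "D \<le> 1 / 2" by fact+
    show "D \<le> signal" unfolding D_def by (rule signal_ge)
    show "exp (- 6 * (\<alpha> / 16) * real (d div 2)) \<le> 1 / 8"
    proof -
      have "- 6 * (\<alpha> / 16) * real (d div 2) \<le> - ln 8" using K ad ln8 by linarith
      then have "exp (- 6 * (\<alpha> / 16) * real (d div 2)) \<le> exp (- ln 8)" by simp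
      also have "\<dots> = 1 / 8" by (simp add: exp_minus)
      finally show ?thesis .
    qed
    show "16 * real n / (real N - real n) \<le> 3 / 80 * (D / real n)"
    proof -
      \<comment> \<open>Writing \<open>N\<close> as a square bounds its logarithm by order
        \<open>n^2\<close>; then \<open>D / n\<close> is at least of order \<open>n^-3\<close>,
        which matches \<open>n / N\<close>.\<close>
      have "ln (real N) = 2 * ln (2048 * (real n)\<^sup>2)"
        unfolding NN using n by (subst ln_realpow) auto
      also have "\<dots> \<le> 2 * (2048 * (real n)\<^sup>2 - 1)"
        using n by (intro mult_left_mono ln_le_minus_one) auto
      finally have "1 + ln (real N) \<le> 4096 * (real n)\<^sup>2" by simp
      then have "1 / (2 * (4096 * (real n)\<^sup>2)) \<le> D"
        unfolding D_def using lnN0 n1 by (intro divide_left_mono mult_left_mono mult_pos_pos) auto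
      then have "3 / 80 * (1 / (2 * (4096 * (real n)\<^sup>2)) / real n) \<le> 3 / 80 * (D / real n)"
        by (intro mult_left_mono divide_right_mono) auto
      moreover have "16 * real n / (real N - real n) \<le> 16 * real n / (4194303 * real n ^ 4)"
      proof -
        have "real n \<le> real n ^ 4" using n1 by (simp add: self_le_power)
        then have le: "4194303 * real n ^ 4 \<le> real N - real n" by (simp add: N_def)
        have pos: "0 < 4194303 * real n ^ 4" using n1 by simp
        show ?thesis
          using le pos less_le_trans[OF pos le] by (intro divide_left_mono mult_pos_pos) auto
      qed
      moreover have "16 * real n / (4194303 * real n ^ 4) \<le> 3 / 80 * (1 / (2 * (4096 * (real n)\<^sup>2)) / real n)"
        using n1 by (simp add: field_simps power2_eq_square power4_eq_xxxx)
      ultimately show ?thesis by linarith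
    qed
    show "exp 1 * real n * exp (- (\<alpha> / 16 * real (d div 2) * D\<^sup>2 / (12500 * (real n)\<^sup>2))) \<le> \<beta> / 8"
    proof -
      have "(1 / (46 * l))\<^sup>2 \<le> D\<^sup>2" using Dl l1 by (intro power_mono) auto
      then have "(\<alpha> * real d / 48) * (1 / (46 * l))\<^sup>2 \<le> \<alpha> / 16 * real (d div 2) * D\<^sup>2"
        using K alpha by (intro mult_mono) auto
      then have "(\<alpha> * real d / 48) * (1 / (46 * l))\<^sup>2 / (12500 * (real n)\<^sup>2) \<le>
          \<alpha> / 16 * real (d div 2) * D\<^sup>2 / (12500 * (real n)\<^sup>2)"
        by (intro divide_right_mono) auto
      moreover have "lb \<le> (\<alpha> * real d / 48) * (1 / (46 * l))\<^sup>2 / (12500 * (real n)\<^sup>2)"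
        using big n1 l1 unfolding l_def[symmetric] lb_def[symmetric]
        by (simp add: field_simps power2_eq_square)
      ultimately have "lb \<le> \<alpha> / 16 * real (d div 2) * D\<^sup>2 / (12500 * (real n)\<^sup>2)" by linarith
      then have "exp 1 * real n * exp (- (\<alpha> / 16 * real (d div 2) * D\<^sup>2 / (12500 * (real n)\<^sup>2))) \<le>
         exp 1 * real n * exp (- lb)"
        using n1 by (intro mult_left_mono) auto
      also have "\<dots> \<le> exp 1 * real n * exp (- 1 - ln 8 - ln (real n / \<beta>))"
        using n1 ln8 unfolding lb_def by (intro mult_left_mono) auto
      also have "\<dots> = \<beta> / 8"
        using n1 beta by (simp add: exp_diff exp_minus)
      finally show ?thesis .
    qed
  qed
qed

text \<open>Without rows every column is marked both 1 and -1, and no answer takes both values on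
  nine tenths of the columns.\<close>

lemma weakly_accurate_sample_pos:
  assumes wacc: "weakly_accurate n d \<alpha> \<beta> M"
    and "0 < \<beta>" "0 < d" "0 < \<alpha>"
  shows "1 \<le> n"
proof (rule ccontr)
  assume "\<not> 1 \<le> n"
  then have n: "n = 0" by simp
  let ?X = "\<lambda>(_::nat) (_::nat). 0::real"
  have X: "dataset n d ?X" by (simp add: dataset_def n)
  have mk: "marked n d ?X b = {..<d}" for b by (auto simp: marked_def n)
  have no: "\<not> strongly_agrees n d q ?X" for q
  proof
    assume "strongly_agrees n d q ?X"
    then have "0.9 * real d \<le> real (card {j \<in> {..<d}. q j = 1})"
      "0.9 * real d \<le> real (card {j \<in> {..<d}. q j = -1})"
      unfolding strongly_agrees_def mk by auto
    moreover have "card {j \<in> {..<d}. q j = 1} + card {j \<in> {..<d}. q j = -1} \<le> card {..<d}"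
      by (subst card_Un_disjoint[symmetric]) (auto simp del: card_lessThan intro!: card_mono)
    ultimately show False using \<open>0 < d\<close> by simp
  qed
  have "(1 - \<alpha>) * real d / 2 \<le> real (card {..<d})"
    using \<open>0 < \<alpha>\<close> mult_right_mono[of "1 - \<alpha>" 1 "real d"] by simp
  then have "\<beta> \<le> measure (M ?X) {q \<in> space (M ?X). strongly_agrees n d q ?X}"
    using wacc[unfolded weakly_accurate_def, rule_format, OF X] unfolding mk by simp
  also have "\<dots> = 0" by (simp add: no)
  finally show False using \<open>0 < \<beta>\<close> by simp
qed

text \<open>The condition \<open>\<alpha> * real d / \<beta> \<ge> 2\<close> keeps the logarithm at
  least \<open>ln 2\<close>. Two logarithms come from the squared signal and one from
  \<open>ln (n / \<beta>)\<close>; the square root turns them into the exponent 1.5.\<close>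

theorem theorem1p4:
  "\<exists>c>0. \<forall>(\<alpha>::real) (\<beta>::real) (n::nat) (d::nat) M.
     \<alpha> \<in> {0<..1} \<longrightarrow> \<beta> \<in> {0<..1} \<longrightarrow> \<alpha> * real d / \<beta> \<ge> 2 \<longrightarrow>
     mechanism n d M \<longrightarrow> weakly_accurate n d \<alpha> \<beta> M \<longrightarrow>
     diff_private n d 1 (\<beta> / (4 * real n)) M \<longrightarrow>
     real n \<ge> c * sqrt (\<alpha> * real d) / (ln (\<alpha> * real d / \<beta>) powr 1.5)"
proof (intro exI[of _ "1 / 1000000"] conjI allI impI)
  fix \<alpha> \<beta> :: real and n d :: nat and M
  assume "\<alpha> \<in> {0<..1}" "\<beta> \<in> {0<..1}" and ratio: "2 \<le> \<alpha> * real d / \<beta>"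
    and mech: "mechanism n d M" and wacc: "weakly_accurate n d \<alpha> \<beta> M"
    and priv: "diff_private n d 1 (\<beta> / (4 * real n)) M"
  then have alpha: "0 < \<alpha>" "\<alpha> \<le> 1" and beta: "0 < \<beta>" "\<beta> \<le> 1" by auto
  define L where "L = ln (\<alpha> * real d / \<beta>)"
  have d: "0 < d" using ratio by (cases d) auto
  have n: "1 \<le> n" using weakly_accurate_sample_pos[OF wacc beta(1) d alpha(1)] .
  have "ln 2 \<le> L" unfolding L_def using ratio by simp
  then have L: "1 / 2 \<le> L" using ln2_ge_two_thirds by simp
  have Lp: "L powr 1.5 = L * sqrt L"
    using L powr_add[of L 1 "1 / 2"] by (simp add: powr_half_sqrt)
  have L0: "0 < L powr 1.5" using L by simp
  have goal: "sqrt (\<alpha> * real d) \<le> 1000000 * real n * L powr 1.5"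
  \<comment> \<open>If \<open>n\<close> is this large, \<open>L powr 1.5 \<ge> 1/4\<close> suffices.
    Otherwise \<open>n \<le> \<alpha> * d\<close>, so the logarithms of \<open>n\<close> and
    \<open>n / \<beta>\<close> are at most \<open>L\<close>.\<close>
  proof (cases "sqrt (\<alpha> * real d) \<le> real n")
    case True
    have "1 / 2 \<le> sqrt L" using L by (intro real_le_rsqrt) (simp add: power2_eq_square)
    then have "1 / 2 * (1 / 2) \<le> L * sqrt L" using L by (intro mult_mono) auto
    then have "real n * 1 \<le> real n * (1000000 * (L * sqrt L))" by (intro mult_left_mono) auto
    then show ?thesis using True unfolding Lp by (simp add: mult_ac)
  next
    case False
    then have "1 \<le> sqrt (\<alpha> * real d)" using n by linarith
    then have ad1: "1 \<le> \<alpha> * real d" by simp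
    then have "sqrt (\<alpha> * real d) \<le> \<alpha> * real d"
      by (intro real_le_lsqrt) (auto simp: power2_eq_square intro: mult_left_mono[of 1 "\<alpha> * real d" "\<alpha> * real d", simplified])
    then have nad: "real n \<le> \<alpha> * real d" using False by linarith
    then have nb: "real n / \<beta> \<le> \<alpha> * real d / \<beta>" using beta by (intro divide_right_mono) auto
    have nb0: "real n \<le> real n / \<beta>" using beta n by (simp add: le_divide_eq mult_left_le)
    have "ln (real n / \<beta>) \<le> L" unfolding L_def using nb n beta ratio by (subst ln_le_cancel_iff) auto
    moreover have "ln (real n) \<le> ln (real n / \<beta>)" using nb0 n beta by (subst ln_le_cancel_iff) auto
    \<comment> \<open>As \<open>L \<ge> 1/2\<close>, the constants 1 and 4 are at most
      \<open>2 * L\<close> and \<open>8 * L\<close>.\<close>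
    ultimately have b1: "1 + ln (real n) \<le> 3 * L" and b2: "4 + ln (real n / \<beta>) \<le> 9 * L" using L by auto
    have ln0: "0 \<le> ln (real n)" using n by simp
    note dimension_upper_bound[OF n alpha beta mech wacc priv]
    also have "1269600000 * (real n)\<^sup>2 * (1 + ln (real n))\<^sup>2 * (4 + ln (real n / \<beta>)) \<le>
        1269600000 * (real n)\<^sup>2 * (3 * L)\<^sup>2 * (9 * L)"
      using b1 b2 L ln0 \<open>ln (real n) \<le> ln (real n / \<beta>)\<close>
      by (intro mult_mono[OF mult_left_mono[OF power_mono]]) auto
    also have "\<dots> = 102837600000 * ((real n)\<^sup>2 * L ^ 3)"
      by (simp add: power2_eq_square power3_eq_cube)
    \<comment> \<open>Rounds up to the square of 1000000, the reciprocal of the witness.\<close>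
    also have "\<dots> \<le> 1000000000000 * ((real n)\<^sup>2 * L ^ 3)"
      using L by (intro mult_right_mono) auto
    also have "\<dots> = (1000000 * real n * (L * sqrt L))\<^sup>2"
      using L by (simp add: power_mult_distrib power2_eq_square power3_eq_cube mult_ac)
    finally have "\<alpha> * real d \<le> (1000000 * real n * (L * sqrt L))\<^sup>2" by simp
    then have "sqrt (\<alpha> * real d) \<le> 1000000 * real n * (L * sqrt L)"
      using L by (intro real_le_lsqrt) auto
    then show ?thesis unfolding Lp .
  qed
  show "1 / 1000000 * sqrt (\<alpha> * real d) / (ln (\<alpha> * real d / \<beta>) powr 1.5) \<le> real n"
    using goal L0 unfolding L_def[symmetric] by (simp add: divide_le_eq mult_ac)
qed simp

end
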